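(* Let $\omega\in\mathbb{R}$, $\lambda\in\mathbb{R}\setminus\{0\}$. In the left regular co-space $(F_\lambda(ISO_\omega(2)),\succ,U_\lambda(\mathfrak{iso}_\omega(2)))$ the generators act on every $f\in F_\lambda(ISO_\omega(2))$ by $$J\succ f=\Bigl[\partial_\varphi-\bar a_1\frac{1-e^{-2\lambda\partial_{a_2}}}{2\lambda}+\omega\,\bar a_2\,\partial_{a_1}-\frac{\lambda}{2}\,\omega\,\bar a_1\,\partial_{a_1}^2\Bigr]f,\qquad P_i\succ f=\partial_{a_i}f\quad(i=1,2).$$ The subalgebra $\mathcal{A}_{\omega,\lambda}=\langle a_1,a_2\rangle$ of $F_\lambda(ISO_\omega(2))$ is stable under this action, and on $\psi(a_1,a_2)\in\mathcal{A}_{\omega,\lambda}$ the action is $$J\triangleright\psi(a_1,a_2)=\Bigl(-\bar a_1\frac{1-e^{-2\lambda\partial_{a_2}}}{2\lambda}+\omega\,\bar a_2\,\partial_{a_1}-\frac{\lambda}{2}\,\omega\,\bar a_1\,\partial_{a_1}^2\Bigr)\psi(a_1,a_2),\qquad P_i\triangleright\psi(a_1,a_2)=\partial_{a_i}\psi(a_1,a_2)\quad(i=1,2).$$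
   Context: The algebra $H=U_\lambda(\mathfrak{iso}_\omega(2))$ is the unital associative complex algebra generated by $J$ and the commutative subalgebra $\mathcal{L}=\mathbb{C}[P_1,P_2,e^{\pm\lambda P_2}]$ of functions on $\mathbb{R}^2$ (with $P_i(\alpha_1,\alpha_2)=\alpha_i$), subject to $[l,J]=\hat J(l)$ for $l\in\mathcal{L}$, where $\hat J$ is the derivation $$\hat J=-\Bigl[\frac{1-e^{-2\lambda P_2}}{2\lambda}+\frac12\lambda\omega P_1^2\Bigr]\frac{\partial}{\partial P_1}+\omega P_1\frac{\partial}{\partial P_2}.$$ As a vector space $H=\bigoplus_{m\ge0}J^m\mathcal{L}$. $F_\lambda(ISO_\omega(2))$ is the dual Hopf algebra, generated by $\varphi,a_1,a_2$ with relations $[a_1,\varphi]=\lambda(1-\mathrm{C}_\omega(\varphi))$, $[a_2,\varphi]=\lambda\,\mathrm{S}_\omega(\varphi)$, $[a_1,a_2]=\lambda a_1$, where $\mathrm{C}_\omega(x)=\frac{e^{\sqrt{-\omega}x}+e^{-\sqrt{-\omega}x}}{2}$, $\mathrm{S}_\omega(x)=\frac{e^{\sqrt{-\omega}x}-e^{-\sqrt{-\omega}x}}{2\sqrt{-\omega}}$ for $\omega\ne0$, $\mathrm{C}_0(x)=1$, $\mathrm{S}_0(x)=x$. Its elements are written in the normal ordering $\varphi^qa_1^ra_2^s$, polynomially in $a_1,a_2$ with coefficients formal power series in $\varphi$ placed on the left; elements of $\mathcal{A}_{\omega,\lambda}$ are the linear combinations of the ordered monomials $a_1^ra_2^s$.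 The pairing with $H$ is determined by $\langle J^mP_1^nP_2^p,\varphi^qa_1^ra_2^s\rangle=m!\,n!\,p!\,\delta_m^q\delta_n^r\delta_p^s$; for general $l\in\mathcal{L}$ it is $\langle J^ml,\varphi^qa_1^ra_2^s\rangle=m!\,\delta_m^q\,(\partial_1^r\partial_2^sl)(0,0)$. The left regular action is defined by $\langle h',h\succ f\rangle=\langle h'h,f\rangle$ for $h,h'\in H$; $\triangleright$ denotes its restriction to $\mathcal{A}_{\omega,\lambda}$. Operators act on normally ordered expressions: $\bar a_1(\varphi^qa_1^ra_2^s)=\varphi^qa_1^{r+1}a_2^s$, $\bar a_2(\varphi^qa_1^ra_2^s)=\varphi^qa_1^ra_2^{s+1}$, and $\partial_\varphi,\partial_{a_1},\partial_{a_2}$ are the formal partial derivatives on ordered monomials; $e^{-2\lambda\partial_{a_2}}$ is the exponential series (a shift of $a_2$ by $-2\lambda$ in normally ordered expressions). *)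

theory Defs
  imports
    "HOL-Analysis.Analysis"
    "HOL-Computational_Algebra.Computational_Algebra"
    "HOL-Library.Function_Algebras"
    "HOL-Library.Groups_Big_Fun"
begin

section \<open>The algebra of functions \<open>\<L> = \<complex>[P\<^sub>1, P\<^sub>2, e\<^bsup>\<plusminus>\<lambda>P\<^sub>2\<^esup>]\<close>\<close>

text \<open>Functions on \<open>\<real>\<^sup>2\<close> are curried and carry the pointwise ring operations.\<close>

type_synonym fun2 = "real \<Rightarrow> real \<Rightarrow> complex"

definition P1 :: fun2 where "P1 = (\<lambda>x y. of_real x)"

definition P2 :: fun2 where "P2 = (\<lambda>x y. of_real y)"

inductive_set Lalg :: "real \<Rightarrow> fun2 set" for lam :: real where
  const: "(\<lambda>x y. c) \<in> Lalg lam"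
| P1: "P1 \<in> Lalg lam"
| P2: "P2 \<in> Lalg lam"
| exp_pos: "(\<lambda>x y. exp (of_real (lam * y))) \<in> Lalg lam"
| exp_neg: "(\<lambda>x y. exp (- of_real (lam * y))) \<in> Lalg lam"
| add: "l \<in> Lalg lam \<Longrightarrow> l' \<in> Lalg lam \<Longrightarrow> l + l' \<in> Lalg lam"
| mult: "l \<in> Lalg lam \<Longrightarrow> l' \<in> Lalg lam \<Longrightarrow> l * l' \<in> Lalg lam"

definition d1 :: "fun2 \<Rightarrow> fun2" where
  "d1 l = (\<lambda>x y. vector_derivative (\<lambda>t. l t y) (at x))"

definition d2 :: "fun2 \<Rightarrow> fun2" where
  "d2 l = (\<lambda>x y. vector_derivative (\<lambda>t. l x t) (at y))"

definition Jhat :: "real \<Rightarrow> real \<Rightarrow> fun2 \<Rightarrow> fun2" where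
  "Jhat \<omega> lam l = (\<lambda>x y.
     - of_real ((1 - exp (- 2 * lam * y)) / (2 * lam) + 1 / 2 * lam * \<omega> * x\<^sup>2) * d1 l x y
     + of_real (\<omega> * x) * d2 l x y)"


section \<open>The algebra \<open>H = U\<^sub>\<lambda>(iso\<^sub>\<omega>(2))\<close>\<close>

text \<open>
  An element \<open>\<Sum>\<^sub>m J\<^sup>m l\<^sub>m\<close> of \<open>H = \<Oplus>\<^sub>m J\<^sup>m \<L>\<close> is encoded by the finitely supported
  sequence \<open>(l\<^sub>m)\<close>, for which we borrow the type \<open>poly\<close>: \<open>monom l m\<close> is \<open>J\<^sup>m l\<close>. Only the additive
  structure of \<open>poly\<close> is used; the product of \<open>H\<close> is \<open>Hmult\<close> below, which is not the
  (commutative) product of the type \<open>poly\<close>.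
\<close>

type_synonym hopf = "fun2 poly"

definition Halg :: "real \<Rightarrow> hopf set" where
  "Halg lam = {h. \<forall>m. coeff h m \<in> Lalg lam}"

definition emb :: "fun2 \<Rightarrow> hopf" where "emb l = monom l 0"

definition genJ :: hopf where "genJ = monom 1 1"

text \<open>
  \<open>norm_ord \<omega> \<lambda> n l l'\<close> is the ordered form of \<open>l J\<^sup>n l'\<close>, obtained by moving \<open>l\<close> to the right
  with \<open>l J = J l + Jhat l\<close>; left multiplication by \<open>J\<close> is the shift \<open>pCons 0\<close>.
\<close>

primrec norm_ord :: "real \<Rightarrow> real \<Rightarrow> nat \<Rightarrow> fun2 \<Rightarrow> fun2 \<Rightarrow> hopf" where
  "norm_ord \<omega> lam 0 l l' = emb (l * l')"
| "norm_ord \<omega> lam (Suc n) l l' =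
     pCons 0 (norm_ord \<omega> lam n l l') + norm_ord \<omega> lam n (Jhat \<omega> lam l) l'"

definition Hmult :: "real \<Rightarrow> real \<Rightarrow> hopf \<Rightarrow> hopf \<Rightarrow> hopf" where
  "Hmult \<omega> lam h h' =
     (\<Sum>m\<le>degree h. \<Sum>n\<le>degree h'.
        (pCons 0 ^^ m) (norm_ord \<omega> lam n (coeff h m) (coeff h' n)))"


text \<open>
  \<open>Hmult_assoc\<close>, \<open>Hmult_one\<close> and \<open>Hrelation\<close> confirm that \<open>Hmult\<close> is the product of \<open>H\<close>.
\<close>

lemma Lalg_diff:
  assumes "l \<in> Lalg lam"
  shows "(\<lambda>t. l t y) differentiable (at x)" "(\<lambda>t. l x t) differentiable (at y)"
proof -
  have e: "(\<lambda>t. exp (complex_of_real (c * t))) differentiable (at y)" for c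
    unfolding exp_of_real
    by (rule differentiableI_vector, rule has_vector_derivative_of_real) (auto intro!: derivative_eq_intros)
  from assms have "((\<lambda>t. l t y) differentiable (at x)) \<and> ((\<lambda>t. l x t) differentiable (at y))"
  proof induction
    case exp_pos
    show ?case using e[of lam] by simp
  next
    case exp_neg
    show ?case using e[of "- lam"] by simp
  qed (auto simp: P1_def P2_def linear_imp_differentiable bounded_linear_imp_differentiable bounded_linear_of_real)
  then show "(\<lambda>t. l t y) differentiable (at x)" "(\<lambda>t. l x t) differentiable (at y)" by auto
qed

lemma d_add:
  assumes "l \<in> Lalg lam" "l' \<in> Lalg lam"
  shows "d1 (l + l') = d1 l + d1 l'" "d2 (l + l') = d2 l + d2 l'"
  using assms by (auto simp: d1_def d2_def fun_eq_iff Lalg_diff intro!: vector_derivative_add_at)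

lemma d_mult:
  assumes "l \<in> Lalg lam" "l' \<in> Lalg lam"
  shows "d1 (l * l') = l * d1 l' + d1 l * l'" "d2 (l * l') = l * d2 l' + d2 l * l'"
  using assms by (auto simp: d1_def d2_def fun_eq_iff Lalg_diff intro!: vector_derivative_mult_at)

lemma Lalg_zero: "0 \<in> Lalg lam" and Lalg_one: "1 \<in> Lalg lam"
  using Lalg.const[of 0 lam] Lalg.const[of 1 lam] by (simp_all add: zero_fun_def one_fun_def)

lemma Lalg_scale:
  assumes "l \<in> Lalg lam" shows "(\<lambda>x y. c * l x y) \<in> Lalg lam"
  using Lalg.mult[OF Lalg.const[of c] assms] by (simp add: times_fun_def)

lemma d_basic:
  "d1 (\<lambda>x y. c) = 0" "d2 (\<lambda>x y. c) = 0" "d1 P1 = 1" "d2 P1 = 0" "d1 P2 = 0" "d2 P2 = 1"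
  "d1 (\<lambda>x y. g y) = 0"
  "d2 (\<lambda>x y. exp (complex_of_real (k * y))) = (\<lambda>x y. of_real k * exp (complex_of_real (k * y)))"
proof -
  have e: "((\<lambda>t. exp (complex_of_real (k * t))) has_vector_derivative of_real k * exp (complex_of_real (k * y))) (at y)" for y
    unfolding exp_of_real of_real_mult[symmetric]
    by (rule has_vector_derivative_of_real) (auto intro!: derivative_eq_intros)
  have i: "((\<lambda>t. complex_of_real t) has_vector_derivative 1) (at y)" for y
    using has_vector_derivative_of_real[of "\<lambda>t. t" 1 "at y"] by (auto intro!: derivative_eq_intros)
  show "d2 (\<lambda>x y. exp (complex_of_real (k * y))) = (\<lambda>x y. of_real k * exp (complex_of_real (k * y)))"
    unfolding d2_def by (intro ext vector_derivative_at e)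
  show "d1 P1 = 1" "d2 P2 = 1"
    unfolding d1_def d2_def P1_def P2_def using i by (simp_all add: vector_derivative_at one_fun_def)
qed (simp_all add: d1_def d2_def P1_def P2_def zero_fun_def)

lemma Lalg_d:
  assumes "l \<in> Lalg lam" shows "d1 l \<in> Lalg lam" "d2 l \<in> Lalg lam"
proof -
  from assms have "d1 l \<in> Lalg lam \<and> d2 l \<in> Lalg lam"
  proof induction
    case exp_pos
    show ?case using Lalg_scale[OF Lalg.exp_pos, of "of_real lam"]
      by (simp only: d_basic Lalg_zero)
  next
    case exp_neg
    have "d2 (\<lambda>x y. exp (- complex_of_real (lam * y))) = (\<lambda>x y. of_real (- lam) * exp (- complex_of_real (lam * y)))"
      using d_basic(8)[of "- lam"] by simp
    with Lalg_scale[OF Lalg.exp_neg, of "of_real (- lam)"] show ?case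
      by (simp only: d_basic Lalg_zero)
  next
    case (add l l')
    then show ?case by (simp only: d_add Lalg.add)
  next
    case (mult l l')
    then show ?case by (simp only: d_mult Lalg.add Lalg.mult)
  qed (simp_all only: d_basic Lalg_zero Lalg_one)
  then show "d1 l \<in> Lalg lam" "d2 l \<in> Lalg lam" by auto
qed

lemma Jhat_zero [simp]: "Jhat \<omega> lam 0 = 0"
  by (simp add: Jhat_def d1_def d2_def zero_fun_def)

lemma Jhat_form:
  obtains u v where "u \<in> Lalg lam" "v \<in> Lalg lam" "\<And>l. Jhat \<omega> lam l = u * d1 l + v * d2 l"
proof
  let ?c = "\<lambda>c. (\<lambda>x y. c) :: fun2" and ?E = "\<lambda>x y :: real. exp (- complex_of_real (lam * y))"
  let ?u = "?c (- 1 / (2 * of_real lam)) + ?c (1 / (2 * of_real lam)) * (?E * ?E)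
        + ?c (- of_real (lam * \<omega> / 2)) * (P1 * P1)"
  show "?u \<in> Lalg lam" "?c (of_real \<omega>) * P1 \<in> Lalg lam"
    by (intro Lalg.intros)+
  have E: "complex_of_real (exp (- 2 * lam * y)) = exp (- complex_of_real (lam * y)) * exp (- complex_of_real (lam * y))" for y
    by (simp add: exp_of_real[symmetric] mult.assoc flip: exp_add)
  show "Jhat \<omega> lam l = ?u * d1 l + ?c (of_real \<omega>) * P1 * d2 l" for l
  proof (intro ext)
    fix x y
    have "- complex_of_real ((1 - exp (- 2 * lam * y)) / (2 * lam) + 1 / 2 * lam * \<omega> * x\<^sup>2) = ?u x y"
      unfolding of_real_add of_real_divide of_real_diff E
      by (simp add: P1_def power2_eq_square diff_divide_distrib)
    then show "Jhat \<omega> lam l x y = (?u * d1 l + ?c (of_real \<omega>) * P1 * d2 l) x y"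
      unfolding Jhat_def by (simp add: P1_def del: of_real_add of_real_divide of_real_diff)
  qed
qed

lemma Jhat_add:
  assumes "l \<in> Lalg lam" "l' \<in> Lalg lam"
  shows "Jhat \<omega> lam (l + l') = Jhat \<omega> lam l + Jhat \<omega> lam l'"
proof -
  obtain u v where "\<And>l. Jhat \<omega> lam l = u * d1 l + v * d2 l" using Jhat_form by metis
  then show ?thesis by (simp only: d_add[OF assms] distrib_left add_ac)
qed

lemma Jhat_mult:
  assumes "l \<in> Lalg lam" "l' \<in> Lalg lam"
  shows "Jhat \<omega> lam (l * l') = Jhat \<omega> lam l * l' + l * Jhat \<omega> lam l'"
proof -
  obtain u v where "\<And>l. Jhat \<omega> lam l = u * d1 l + v * d2 l" using Jhat_form by metis
  then show ?thesis by (simp only: d_mult[OF assms] distrib_left distrib_right add_ac mult_ac)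
qed

lemma Lalg_Jhat:
  assumes "l \<in> Lalg lam" shows "Jhat \<omega> lam l \<in> Lalg lam"
  using Lalg_d[OF assms] by (metis Jhat_form Lalg.add Lalg.mult)

lemma add_pCons_0: "pCons 0 (h + k) = pCons 0 h + pCons 0 (k :: hopf)"
  by simp

lemma norm_ord_add_right:
  "norm_ord \<omega> lam n l (l1 + l2) = norm_ord \<omega> lam n l l1 + norm_ord \<omega> lam n l l2"
  by (induction n arbitrary: l) (simp_all add: emb_def distrib_left add_ac add_pCons_0 del: add_pCons flip: add_monom)

lemma norm_ord_add_left:
  "l1 \<in> Lalg lam \<Longrightarrow> l2 \<in> Lalg lam \<Longrightarrow>
     norm_ord \<omega> lam n (l1 + l2) l = norm_ord \<omega> lam n l1 l + norm_ord \<omega> lam n l2 l"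
  by (induction n arbitrary: l1 l2)
     (simp_all add: emb_def distrib_right Jhat_add Lalg_Jhat add_ac add_pCons_0 del: add_pCons flip: add_monom)

lemma norm_ord_zero [simp]: "norm_ord \<omega> lam n l 0 = 0" "norm_ord \<omega> lam n 0 l = 0"
  by (induction n arbitrary: l) (simp_all add: emb_def)

definition Lact :: "real \<Rightarrow> real \<Rightarrow> fun2 \<Rightarrow> hopf \<Rightarrow> hopf" where
  "Lact \<omega> lam l h = (\<Sum>n\<le>degree h. norm_ord \<omega> lam n l (coeff h n))"

lemma Lact_bound: "degree h \<le> N \<Longrightarrow> Lact \<omega> lam l h = (\<Sum>n\<le>N. norm_ord \<omega> lam n l (coeff h n))"
  unfolding Lact_def by (intro sum.mono_neutral_left) (auto simp: coeff_eq_0)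

lemma Lact_add: "Lact \<omega> lam l (h + k) = Lact \<omega> lam l h + Lact \<omega> lam l k"
  using Lact_bound[of "h + k" "max (degree h) (degree k)" \<omega> lam l]
    Lact_bound[of h "max (degree h) (degree k)" \<omega> lam l]
    Lact_bound[of k "max (degree h) (degree k)" \<omega> lam l]
  by (simp add: degree_add_le norm_ord_add_right sum.distrib)

lemma Lact_add_left: "l1 \<in> Lalg lam \<Longrightarrow> l2 \<in> Lalg lam \<Longrightarrow>
  Lact \<omega> lam (l1 + l2) h = Lact \<omega> lam l1 h + Lact \<omega> lam l2 h"
  by (simp add: Lact_def norm_ord_add_left sum.distrib)

lemma Lact_zero [simp]: "Lact \<omega> lam l 0 = 0" "Lact \<omega> lam 0 h = 0"
  by (simp_all add: Lact_def)

lemma Lact_emb: "Lact \<omega> lam l (emb l') = emb (l * l')"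
  by (simp add: Lact_def emb_def monom_0)

lemma pCons_sum: "pCons 0 (\<Sum>i\<in>A. f i) = (\<Sum>i\<in>A. pCons 0 (f i :: hopf))"
  by (intro poly_eqI) (simp add: coeff_sum coeff_pCons split: nat.split)

lemma Lact_pCons: "Lact \<omega> lam l (pCons 0 h) = pCons 0 (Lact \<omega> lam l h) + Lact \<omega> lam (Jhat \<omega> lam l) h"
proof -
  have "Lact \<omega> lam l (pCons 0 h) = (\<Sum>n\<le>Suc (degree h). norm_ord \<omega> lam n l (coeff (pCons 0 h) n))"
    by (rule Lact_bound) (simp add: degree_pCons_le)
  also have "\<dots> = (\<Sum>n\<le>degree h. norm_ord \<omega> lam (Suc n) l (coeff h n))"
    by (subst sum.atMost_Suc_shift) simp
  finally show ?thesis by (simp add: sum.distrib pCons_sum Lact_def)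
qed

lemma Halg_add: "h \<in> Halg lam \<Longrightarrow> k \<in> Halg lam \<Longrightarrow> h + k \<in> Halg lam"
  by (simp add: Halg_def Lalg.add)

lemma Halg_pCons: "pCons l h \<in> Halg lam \<longleftrightarrow> l \<in> Lalg lam \<and> h \<in> Halg lam"
proof
  assume h: "pCons l h \<in> Halg lam"
  then have "coeff (pCons l h) 0 \<in> Lalg lam" "coeff (pCons l h) (Suc n) \<in> Lalg lam" for n
    unfolding Halg_def by blast+
  then show "l \<in> Lalg lam \<and> h \<in> Halg lam" by (simp add: Halg_def)
qed (simp add: Halg_def coeff_pCons split: nat.split)

lemma Halg_emb: "l \<in> Lalg lam \<Longrightarrow> emb l \<in> Halg lam"
  by (simp add: Halg_def emb_def coeff_monom Lalg_zero)

lemma Halg_induct [consumes 1, case_names zero step]: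
  assumes "h \<in> Halg lam" "P 0"
    "\<And>l h. l \<in> Lalg lam \<Longrightarrow> h \<in> Halg lam \<Longrightarrow> P h \<Longrightarrow> P (emb l + pCons 0 h)"
  shows "P h"
  using assms(1)
proof (induction h)
  case (pCons l h)
  then have "P (emb l + pCons 0 h)" using assms(3) Halg_pCons by blast
  then show ?case by (simp add: emb_def monom_0)
qed (rule assms(2))

lemma Lact_Halg: "h \<in> Halg lam \<Longrightarrow> l \<in> Lalg lam \<Longrightarrow> Lact \<omega> lam l h \<in> Halg lam"
proof (induction arbitrary: l rule: Halg_induct)
  case zero then show ?case by (simp add: Halg_def Lalg_zero)
next
  case (step l' h)
  then show ?case
    by (simp add: Lact_add Lact_emb Lact_pCons Halg_add Halg_emb Lalg.mult Halg_pCons Lalg_zero Lalg_Jhat)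
qed

lemma Lact_Lact: "h \<in> Halg lam \<Longrightarrow> l \<in> Lalg lam \<Longrightarrow> l' \<in> Lalg lam \<Longrightarrow>
  Lact \<omega> lam l (Lact \<omega> lam l' h) = Lact \<omega> lam (l * l') h"
proof (induction arbitrary: l l' rule: Halg_induct)
  case (step l'' h)
  have "Lact \<omega> lam (l * l') (pCons 0 h) = Lact \<omega> lam l (Lact \<omega> lam l' (pCons 0 h))"
    using step by (simp add: Lact_pCons Lact_add Jhat_mult Lact_add_left Lalg_Jhat Lalg.mult
        del: times_fun_apply)
  then show ?case by (simp add: Lact_add Lact_emb mult.assoc del: times_fun_apply)
qed simp

lemma Hmult_Lact: "Hmult \<omega> lam h k = (\<Sum>m\<le>degree h. (pCons 0 ^^ m) (Lact \<omega> lam (coeff h m) k))"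
proof -
  have "(pCons 0 ^^ m) (\<Sum>i\<in>A. f i) = (\<Sum>i\<in>A. (pCons 0 ^^ m) (f i :: hopf))" for m A and f :: "nat \<Rightarrow> hopf"
    by (induction m) (simp_all add: pCons_sum del: zero_fun_apply)
  then show ?thesis by (simp add: Hmult_def Lact_def)
qed

lemma pCons_pow_zero [simp]: "(pCons 0 ^^ m) (0 :: hopf) = 0"
  by (induction m) (simp_all del: zero_fun_apply)

lemma Hmult_pCons:
  "Hmult \<omega> lam (pCons l h) k = Lact \<omega> lam l k + pCons 0 (Hmult \<omega> lam h k)"
proof -
  have "Hmult \<omega> lam (pCons l h) k =
      (\<Sum>m\<le>Suc (degree h). (pCons 0 ^^ m) (Lact \<omega> lam (coeff (pCons l h) m) k))"
    unfolding Hmult_Lact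
    by (intro sum.mono_neutral_left) (auto simp: coeff_eq_0 degree_pCons_le)
  also have "\<dots> = Lact \<omega> lam l k + pCons 0 (Hmult \<omega> lam h k)"
    by (subst sum.atMost_Suc_shift) (simp add: Hmult_Lact pCons_sum)
  finally show ?thesis .
qed

lemma Hmult_zero [simp]: "Hmult \<omega> lam 0 k = 0"
  by (simp add: Hmult_Lact)

lemma Hmult_add:
  "h \<in> Halg lam \<Longrightarrow> h' \<in> Halg lam \<Longrightarrow>
     Hmult \<omega> lam (h + h') k = Hmult \<omega> lam h k + Hmult \<omega> lam h' k"
proof (induction h arbitrary: h')
  case (pCons l h)
  obtain l' g where h': "h' = pCons l' g" by (cases h')
  have "Hmult \<omega> lam (h + g) k = Hmult \<omega> lam h k + Hmult \<omega> lam g k"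
    using pCons h' Halg_pCons by blast
  then show ?case
    using pCons.prems by (simp add: h' Hmult_pCons Halg_pCons Lact_add_left del: plus_fun_apply)
qed simp

lemma emb_pCons: "emb l = pCons l 0"
  by (simp add: emb_def monom_0)

lemma Hmult_Lact_left:
  "h \<in> Halg lam \<Longrightarrow> k \<in> Halg lam \<Longrightarrow> l \<in> Lalg lam \<Longrightarrow>
     Hmult \<omega> lam (Lact \<omega> lam l h) k = Lact \<omega> lam l (Hmult \<omega> lam h k)"
proof (induction arbitrary: l rule: Halg_induct)
  case (step l' h)
  have "Hmult \<omega> lam (Lact \<omega> lam l (emb l' + pCons 0 h)) k =
     Lact \<omega> lam (l * l') k + (pCons 0 (Lact \<omega> lam l (Hmult \<omega> lam h k))
        + Lact \<omega> lam (Jhat \<omega> lam l) (Hmult \<omega> lam h k))"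
    using step
    by (simp add: Lact_add Lact_emb Lact_pCons Hmult_add Halg_add Halg_emb Halg_pCons Lalg_zero
        Lalg.mult Lact_Halg Lalg_Jhat Hmult_pCons) (simp add: emb_pCons Hmult_pCons)
  also have "\<dots> = Lact \<omega> lam l (Hmult \<omega> lam (emb l' + pCons 0 h) k)"
    using step by (simp add: emb_pCons Hmult_pCons Lact_add Lact_pCons Lact_Lact)
  finally show ?case .
qed simp

lemma Hmult_Halg: "h \<in> Halg lam \<Longrightarrow> k \<in> Halg lam \<Longrightarrow> Hmult \<omega> lam h k \<in> Halg lam"
proof (induction rule: Halg_induct)
  case zero
  then show ?case by (simp add: Halg_def Lalg_zero)
next
  case (step l h)
  then show ?case by (simp add: emb_pCons Hmult_pCons Halg_add Lact_Halg Halg_pCons Lalg_zero)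
qed

lemma Hmult_assoc:
  "h \<in> Halg lam \<Longrightarrow> h' \<in> Halg lam \<Longrightarrow> k \<in> Halg lam \<Longrightarrow>
     Hmult \<omega> lam (Hmult \<omega> lam h h') k = Hmult \<omega> lam h (Hmult \<omega> lam h' k)"
proof (induction rule: Halg_induct)
  case (step l h)
  have "Hmult \<omega> lam h h' \<in> Halg lam"
    using step(2,4) by (rule Hmult_Halg)
  with step show ?case
    by (simp add: emb_pCons Hmult_pCons Hmult_add Lact_Halg Halg_pCons Lalg_zero Hmult_Lact_left)
qed simp

lemma Hmult_one: "Hmult \<omega> lam (emb 1) h = h" "Hmult \<omega> lam h (emb 1) = h"
proof -
  have "Lact \<omega> lam 1 h = h" for h
  proof (induction h)
    case (pCons l h)
    have "Jhat \<omega> lam 1 = 0"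
      unfolding Jhat_def by (simp add: one_fun_def d_basic zero_fun_def)
    then have "Lact \<omega> lam 1 (emb l + pCons 0 h) = emb l + pCons 0 h"
      by (simp only: Lact_add Lact_emb Lact_pCons pCons.IH Lact_zero) simp
    then show ?case by (simp add: emb_pCons del: one_fun_apply)
  qed simp
  then show "Hmult \<omega> lam (emb 1) h = h" by (simp add: emb_pCons Hmult_pCons)
  show "Hmult \<omega> lam h (emb 1) = h"
    by (induction h) (simp_all add: Hmult_pCons Lact_emb[unfolded emb_pCons] emb_pCons del: one_fun_apply)
qed

lemma Hrelation:
  "Hmult \<omega> lam (emb l) genJ - Hmult \<omega> lam genJ (emb l) = emb (Jhat \<omega> lam l)"
proof -
  have J: "genJ = pCons 0 (emb 1)" by (simp add: genJ_def emb_def monom_Suc)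
  have "Hmult \<omega> lam (emb l) genJ = pCons 0 (emb l) + emb (Jhat \<omega> lam l)"
    by (simp add: J emb_pCons[of l] Hmult_pCons Lact_pCons Lact_emb)
  moreover have "Hmult \<omega> lam genJ (emb l) = pCons 0 (emb l)"
    by (simp add: J Hmult_pCons Hmult_one)
  ultimately show ?thesis by simp
qed


section \<open>The dual algebra \<open>F\<^sub>\<lambda>(ISO\<^sub>\<omega>(2))\<close>\<close>

text \<open>
  The normally ordered expression \<open>\<Sum>\<^sub>r\<^sub>s c\<^sub>r\<^sub>s(\<phi>) a\<^sub>1\<^sup>r a\<^sub>2\<^sup>s\<close> is encoded with \<open>a\<^sub>2\<close> as the outer
  polynomial variable: \<open>c\<^sub>r\<^sub>s = coeff (coeff f s) r\<close>. The product of \<open>F\<^sub>\<lambda>(ISO\<^sub>\<omega>(2))\<close> is \<open>Fmult\<close>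
  below, not the commutative product of the type.
\<close>

type_synonym dualF = "complex fps poly poly"

definition monoF :: "nat \<Rightarrow> nat \<Rightarrow> nat \<Rightarrow> dualF" where
  "monoF q r s = monom (monom (fps_X ^ q) r) s"

definition lcoef :: "complex fps \<Rightarrow> dualF \<Rightarrow> dualF" where
  "lcoef c f = smult [:c:] f"

abbreviation cscale :: "complex \<Rightarrow> dualF \<Rightarrow> dualF" where
  "cscale c \<equiv> lcoef (fps_const c)"

definition abar1 :: "dualF \<Rightarrow> dualF" where "abar1 f = smult [:0, 1:] f"

definition abar2 :: "dualF \<Rightarrow> dualF" where "abar2 f = pCons 0 f"

definition dphi :: "dualF \<Rightarrow> dualF" where "dphi f = map_poly (map_poly fps_deriv) f"

definition da1 :: "dualF \<Rightarrow> dualF" where "da1 f = map_poly pderiv f"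

definition da2 :: "dualF \<Rightarrow> dualF" where "da2 f = pderiv f"

text \<open>
  The series \<open>e\<^bsup>t \<partial>\<^esup> = \<Sum>\<^sub>k t\<^sup>k/k! \<partial>\<^sup>k\<close> with \<open>\<partial> = da2\<close>; as \<open>da2\<close> is locally nilpotent, only finitely
  many terms are nonzero on a given \<open>f\<close>.
\<close>

definition exp_da2 :: "complex \<Rightarrow> dualF \<Rightarrow> dualF" where
  "exp_da2 t f = Sum_any (\<lambda>k. cscale (t ^ k / fact k) ((da2 ^^ k) f))"

definition Cw :: "real \<Rightarrow> complex fps" where
  "Cw \<omega> = (if \<omega> = 0 then 1 else
     fps_const (1 / 2) * (fps_exp (csqrt (- of_real \<omega>)) + fps_exp (- csqrt (- of_real \<omega>))))"

definition Sw :: "real \<Rightarrow> complex fps" where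
  "Sw \<omega> = (if \<omega> = 0 then fps_X else
     fps_const (1 / (2 * csqrt (- of_real \<omega>))) *
       (fps_exp (csqrt (- of_real \<omega>)) - fps_exp (- csqrt (- of_real \<omega>))))"

text \<open>
  \<open>left_a1\<close> and \<open>left_a2\<close> are the ordered forms of \<open>a\<^sub>1 f\<close> and \<open>a\<^sub>2 f\<close>. They come from
  \<open>[\<phi>, a\<^sub>1] = \<lambda>(1 - C\<^sub>\<omega>(\<phi>))\<close>, \<open>[\<phi>, a\<^sub>2] = \<lambda> S\<^sub>\<omega>(\<phi>)\<close> and \<open>[a\<^sub>1, a\<^sub>2] = \<lambda> a\<^sub>1\<close>, i.e. from
  \<open>a\<^sub>1 c(\<phi>) = c(\<phi>) a\<^sub>1 - \<lambda>(1 - C\<^sub>\<omega>(\<phi>)) c'(\<phi>)\<close>, \<open>a\<^sub>2 c(\<phi>) = c(\<phi>) a\<^sub>2 - \<lambda> S\<^sub>\<omega>(\<phi>) c'(\<phi>)\<close> and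
  \<open>a\<^sub>2 a\<^sub>1\<^sup>r = a\<^sub>1\<^sup>r a\<^sub>2 - r \<lambda> a\<^sub>1\<^sup>r\<close>. The first two are also found in the literature with \<open>[a\<^sub>i, \<phi>]\<close> on the
  left; together with \<open>[a\<^sub>1, a\<^sub>2] = \<lambda> a\<^sub>1\<close> that contradicts the Jacobi identity for \<open>\<omega> \<noteq> 0\<close>, and it is
  not dual to \<open>\<Delta> P\<^sub>2 = P\<^sub>2 \<otimes> 1 + 1 \<otimes> P\<^sub>2\<close>, \<open>\<Delta> X = X \<otimes> 1 + e\<^bsup>-\<lambda>P\<^sub>2\<^esup> \<otimes> X\<close> (\<open>X = P\<^sub>1, J\<close>). The product enters only
  through the subalgebra \<open>Aalg\<close>, which depends on the relation \<open>[a\<^sub>1, a\<^sub>2] = \<lambda> a\<^sub>1\<close> alone.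
\<close>

definition left_a1 :: "real \<Rightarrow> real \<Rightarrow> dualF \<Rightarrow> dualF" where
  "left_a1 \<omega> lam f = abar1 f - lcoef (fps_const (of_real lam) * (1 - Cw \<omega>)) (dphi f)"

definition left_a2 :: "real \<Rightarrow> real \<Rightarrow> dualF \<Rightarrow> dualF" where
  "left_a2 \<omega> lam f = abar2 f - cscale (of_real lam) (abar1 (da1 f))
     - lcoef (fps_const (of_real lam) * Sw \<omega>) (dphi f)"

definition Fmult :: "real \<Rightarrow> real \<Rightarrow> dualF \<Rightarrow> dualF \<Rightarrow> dualF" where
  "Fmult \<omega> lam f g =
     (\<Sum>s\<le>degree f. \<Sum>r\<le>degree (coeff f s).
        lcoef (coeff (coeff f s) r) ((left_a1 \<omega> lam ^^ r) ((left_a2 \<omega> lam ^^ s) g)))"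

inductive_set Aalg :: "real \<Rightarrow> real \<Rightarrow> dualF set" for \<omega> lam :: real where
  one: "1 \<in> Aalg \<omega> lam"
| a1: "monoF 0 1 0 \<in> Aalg \<omega> lam"
| a2: "monoF 0 0 1 \<in> Aalg \<omega> lam"
| scale: "f \<in> Aalg \<omega> lam \<Longrightarrow> cscale c f \<in> Aalg \<omega> lam"
| add: "f \<in> Aalg \<omega> lam \<Longrightarrow> g \<in> Aalg \<omega> lam \<Longrightarrow> f + g \<in> Aalg \<omega> lam"
| mult: "f \<in> Aalg \<omega> lam \<Longrightarrow> g \<in> Aalg \<omega> lam \<Longrightarrow> Fmult \<omega> lam f g \<in> Aalg \<omega> lam"


text \<open>
  \<open>Fmult_assoc\<close>, \<open>Fmult_one\<close> and \<open>Frelations\<close> confirm that \<open>Fmult\<close> is an associative unital product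
  with the stated relations, and \<open>Aalg_eq\<close> that \<open>Aalg\<close> consists of the complex linear combinations
  of the ordered monomials \<open>a\<^sub>1\<^sup>r a\<^sub>2\<^sup>s\<close>.
\<close>

lemma coeff_lcoef: "coeff (coeff (lcoef c f) s) r = c * coeff (coeff f s) r"
  by (simp add: lcoef_def)
lemma coeff_abar1: "coeff (coeff (abar1 f) s) r = (case r of 0 \<Rightarrow> 0 | Suc r' \<Rightarrow> coeff (coeff f s) r')"
  by (simp add: abar1_def coeff_pCons)
lemma coeff_abar2: "coeff (coeff (abar2 f) s) r = (case s of 0 \<Rightarrow> 0 | Suc s' \<Rightarrow> coeff (coeff f s') r)"
  by (simp add: abar2_def coeff_pCons split: nat.split)
lemma coeff_dphi: "coeff (coeff (dphi f) s) r = fps_deriv (coeff (coeff f s) r)"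
  by (simp add: dphi_def coeff_map_poly map_poly_0)
lemma coeff_da1: "coeff (coeff (da1 f) s) r = of_nat (Suc r) * coeff (coeff f s) (Suc r)"
  by (simp add: da1_def coeff_map_poly coeff_pderiv)

lemmas Fcoeffs = coeff_lcoef coeff_abar1 coeff_abar2 coeff_dphi coeff_da1

lemma dualF_eqI: "(\<And>s r. coeff (coeff f s) r = coeff (coeff g s) r) \<Longrightarrow> f = (g :: dualF)"
  by (intro poly_eqI)

lemma Cw_deriv: "fps_deriv (Cw \<omega>) = - fps_const (of_real \<omega>) * Sw \<omega>"
proof (cases "\<omega> = 0")
  case False
  define k where "k = csqrt (- of_real \<omega>)"
  have k0: "k \<noteq> 0" using False by (simp add: k_def)
  have k2: "of_real \<omega> = - (k * k)" unfolding k_def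
    by (metis minus_minus power2_csqrt power2_eq_square)
  have "fps_deriv (Cw \<omega>) = fps_const (1/2) * (fps_const k * fps_exp k - fps_const k * fps_exp (- k))"
    using False by (simp add: Cw_def k_def[symmetric] fps_const_neg[symmetric] del: fps_const_neg)
  also have "\<dots> = fps_const (k * k) * (fps_const (1/(2*k)) * (fps_exp k - fps_exp (- k)))"
    using k0 by (simp add: mult.assoc[symmetric] right_diff_distrib)
  also have "\<dots> = - fps_const (of_real \<omega>) * Sw \<omega>"
    unfolding k2 using False by (simp add: Sw_def k_def[symmetric] del: mult_eq_0_iff)
  finally show ?thesis .
qed (simp add: Cw_def)

lemma Sw_deriv: "fps_deriv (Sw \<omega>) = Cw \<omega>"
proof (cases "\<omega> = 0")
  case False
  define k where "k = csqrt (- of_real \<omega>)"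
  have k0: "k \<noteq> 0" using False by (simp add: k_def)
  show ?thesis
    using False k0 by (simp add: Cw_def Sw_def k_def[symmetric] mult.assoc[symmetric] distrib_left right_diff_distrib
        flip: fps_const_neg)
qed (simp add: Cw_def Sw_def)

lemma CS_square: "Cw \<omega> * Cw \<omega> + fps_const (of_real \<omega>) * (Sw \<omega> * Sw \<omega>) = 1"
proof -
  let ?f = "Cw \<omega> * Cw \<omega> + fps_const (of_real \<omega>) * (Sw \<omega> * Sw \<omega>)"
  have "fps_deriv ?f = fps_deriv 1"
    by (simp add: Cw_deriv Sw_deriv algebra_simps flip: fps_const_neg)
  moreover have "fps_nth ?f 0 = 1"
    by (simp add: Cw_def Sw_def fps_mult_nth_0)
  ultimately show ?thesis
    by (subst (asm) fps_deriv_eq_iff) simp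
qed

lemma add_ops:
  "abar1 (f + g) = abar1 f + abar1 g" "abar2 (f + g) = abar2 f + abar2 g"
  "lcoef c (f + g) = lcoef c f + lcoef c g" "dphi (f + g) = dphi f + dphi g"
  "da1 (f + g) = da1 f + da1 g"
  "left_a1 \<omega> lam (f + g) = left_a1 \<omega> lam f + left_a1 \<omega> lam g"
  "left_a2 \<omega> lam (f + g) = left_a2 \<omega> lam f + left_a2 \<omega> lam g"
  unfolding left_a1_def left_a2_def
  by (intro dualF_eqI; simp add: Fcoeffs algebra_simps split: nat.split)+

lemma lcoef_left_a1:
  "left_a1 \<omega> lam (lcoef c f) = lcoef c (left_a1 \<omega> lam f)
     + lcoef (- (fps_const (of_real lam) * (1 - Cw \<omega>)) * fps_deriv c) f"
  unfolding left_a1_def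
  by (intro dualF_eqI; simp add: Fcoeffs algebra_simps split: nat.split)

lemma lcoef_left_a2:
  "left_a2 \<omega> lam (lcoef c f) = lcoef c (left_a2 \<omega> lam f)
     + lcoef (- (fps_const (of_real lam) * Sw \<omega>) * fps_deriv c) f"
  unfolding left_a2_def
  by (intro dualF_eqI; simp add: Fcoeffs algebra_simps split: nat.split)

lemma left_a12:
  "left_a2 \<omega> lam (left_a1 \<omega> lam f)
     = left_a1 \<omega> lam (left_a2 \<omega> lam f) - cscale (of_real lam) (left_a1 \<omega> lam f)"
proof (intro dualF_eqI)
  fix s r
  define C S w l where "C = Cw \<omega>" and "S = Sw \<omega>" and "w = fps_const (complex_of_real \<omega>)"
    and "l = fps_const (complex_of_real lam)"
  have d: "fps_deriv C = - w * S" "fps_deriv S = C" "fps_deriv l = 0"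
    by (simp_all add: C_def S_def w_def l_def Cw_deriv Sw_deriv)
  have "C * C + w * (S * S) = 1" unfolding C_def S_def w_def by (rule CS_square)
  then have sq: "w * (S * S) = 1 - C * C" by (simp add: algebra_simps)
  have sq': "S * (S * (l * (l * (w * x)))) = l * (l * x) - C * (C * (l * (l * x)))" for x
    using arg_cong[OF sq, of "\<lambda>t. t * (l * (l * x))"] by (simp add: algebra_simps)
  show "coeff (coeff (left_a2 \<omega> lam (left_a1 \<omega> lam f)) s) r
     = coeff (coeff (left_a1 \<omega> lam (left_a2 \<omega> lam f) - cscale (of_real lam) (left_a1 \<omega> lam f)) s) r"
    unfolding left_a1_def left_a2_def C_def[symmetric] S_def[symmetric] l_def[symmetric]
    apply (simp add: Fcoeffs d split: nat.split)
    apply (simp add: Fcoeffs d algebra_simps sq' split: nat.split)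
    done
qed


lemma lcoef_simps [simp]:
  "lcoef 0 f = 0" "lcoef c 0 = 0" "lcoef 1 f = f" "lcoef c (lcoef d f) = lcoef (c * d) f"
  by (intro dualF_eqI; simp add: Fcoeffs algebra_simps)+

lemma lcoef_add_left: "lcoef (c + d) f = lcoef c f + lcoef d f"
  by (intro dualF_eqI) (simp add: Fcoeffs algebra_simps)

lemma lcoef_minus_left: "lcoef (- c) f = - lcoef c f"
  by (intro dualF_eqI) (simp add: Fcoeffs)

lemma left_zero [simp]: "left_a1 \<omega> lam 0 = 0" "left_a2 \<omega> lam 0 = 0"
  using add_ops(6,7)[of \<omega> lam 0 0] by (simp_all only: add_0_right add_cancel_right_right)

lemma left_pow_add:
  "(left_a1 \<omega> lam ^^ r) (f + g) = (left_a1 \<omega> lam ^^ r) f + (left_a1 \<omega> lam ^^ r) g"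
  "(left_a2 \<omega> lam ^^ r) (f + g) = (left_a2 \<omega> lam ^^ r) f + (left_a2 \<omega> lam ^^ r) g"
  by (induction r) (simp_all add: add_ops)

lemma Fmult_bound:
  assumes "degree f \<le> N" "\<And>s. degree (coeff f s) \<le> M"
  shows "Fmult \<omega> lam f g = (\<Sum>s\<le>N. \<Sum>r\<le>M.
    lcoef (coeff (coeff f s) r) ((left_a1 \<omega> lam ^^ r) ((left_a2 \<omega> lam ^^ s) g)))"
proof -
  have "Fmult \<omega> lam f g = (\<Sum>s\<le>degree f. \<Sum>r\<le>M.
    lcoef (coeff (coeff f s) r) ((left_a1 \<omega> lam ^^ r) ((left_a2 \<omega> lam ^^ s) g)))"
    unfolding Fmult_def
    by (intro sum.cong[OF refl] sum.mono_neutral_left)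
       (use assms(2) in \<open>auto simp: coeff_eq_0\<close>)
  also have "\<dots> = (\<Sum>s\<le>N. \<Sum>r\<le>M.
    lcoef (coeff (coeff f s) r) ((left_a1 \<omega> lam ^^ r) ((left_a2 \<omega> lam ^^ s) g)))"
    by (intro sum.mono_neutral_left) (use assms(1) in \<open>auto simp: coeff_eq_0\<close>)
  finally show ?thesis .
qed

lemma inner_degree_bound: "\<exists>M. \<forall>s. degree (coeff f s) \<le> M" for f :: dualF
proof (intro exI allI)
  fix s
  show "degree (coeff f s) \<le> Max ((\<lambda>s. degree (coeff f s)) ` {..Suc (degree f)})"
  proof (cases "s \<le> degree f")
    case False
    then show ?thesis by (simp add: coeff_eq_0)
  qed (auto intro!: Max_ge)
qed

lemma Fmult_add_left: "Fmult \<omega> lam (f + f') g = Fmult \<omega> lam f g + Fmult \<omega> lam f' g"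
proof -
  obtain M M' where M: "\<And>s. degree (coeff f s) \<le> M" "\<And>s. degree (coeff f' s) \<le> M'"
    using inner_degree_bound by metis
  let ?M = "max M M'" and ?N = "max (degree f) (degree f')"
  have d: "degree (coeff (f + f') s) \<le> ?M" for s
    using M[of s] by (simp) (meson degree_add_le max.cobounded1 max.cobounded2 order_trans)
  have "degree (f + f') \<le> ?N" by (simp add: degree_add_le)
  from Fmult_bound[OF this d] show ?thesis
    using Fmult_bound[of f ?N ?M \<omega> lam g] Fmult_bound[of f' ?N ?M \<omega> lam g] M
    by (simp add: le_max_iff_disj lcoef_add_left sum.distrib)
qed

lemma Fmult_add_right: "Fmult \<omega> lam f (g + g') = Fmult \<omega> lam f g + Fmult \<omega> lam f g'"
  by (simp add: Fmult_def left_pow_add add_ops sum.distrib)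

lemma Fmult_zero [simp]: "Fmult \<omega> lam 0 g = 0" "Fmult \<omega> lam f 0 = 0"
  using Fmult_add_left[of \<omega> lam 0 0 g] Fmult_add_right[of \<omega> lam f 0 0]
  by (simp_all only: add_0_right add_cancel_right_right)

lemma Fmult_monom:
  "Fmult \<omega> lam (monom (monom c r) s) g =
     lcoef c ((left_a1 \<omega> lam ^^ r) ((left_a2 \<omega> lam ^^ s) g))"
proof -
  have "Fmult \<omega> lam (monom (monom c r) s) g = (\<Sum>s'\<le>s. \<Sum>r'\<le>r. if s' = s then if r' = r then 
     lcoef c ((left_a1 \<omega> lam ^^ r) ((left_a2 \<omega> lam ^^ s) g)) else 0 else 0)"
    by (subst Fmult_bound[of _ s r])
       (auto simp: degree_monom_le coeff_monom intro!: sum.cong)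
  also have "\<dots> = (\<Sum>s'\<le>s. if s' = s then (\<Sum>r'\<le>r. if r' = r then 
     lcoef c ((left_a1 \<omega> lam ^^ r) ((left_a2 \<omega> lam ^^ s) g)) else 0) else 0)"
    by (intro sum.cong) auto
  finally show ?thesis by simp
qed

lemma dualF_induct [case_names add monom]:
  assumes add: "\<And>f g. P f \<Longrightarrow> P g \<Longrightarrow> P (f + g)"
    and monom: "\<And>c r s. P (monom (monom c r) s)"
  shows "P (f :: dualF)"
proof -
  have z: "P 0" using monom[of 0 0 0] by simp
  have fin: "P (\<Sum>i\<in>A. F i)" if "finite A" "\<And>i. i \<in> A \<Longrightarrow> P (F i)" for A :: "nat set" and F
    using that by (induction A) (auto intro: z add)
  have monom_sum: "monom (\<Sum>i\<in>A. F i) s = (\<Sum>i\<in>A. monom (F i) s)" if "finite A"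
    for A :: "nat set" and F :: "nat \<Rightarrow> complex fps poly" and s
    using that by (induction A) (auto simp: add_monom[symmetric])
  have inner: "P (monom p s)" for p s
    by (subst poly_as_sum_of_monoms[of p, symmetric], subst monom_sum)
       (auto intro!: fin monom)
  show ?thesis
    by (subst poly_as_sum_of_monoms[of f, symmetric]) (auto intro!: fin inner)
qed

lemma ops_monom:
  "lcoef d (monom (monom c r) s) = monom (monom (d * c) r) s"
  "abar1 (monom (monom c r) s) = monom (monom c (Suc r)) s"
  "abar2 (monom (monom c r) s) = monom (monom c r) (Suc s)"
  "dphi (monom (monom c r) s) = monom (monom (fps_deriv c) r) s"
  "abar1 (da1 (monom (monom c r) s)) = monom (monom (of_nat r * c) r) s"
  by (intro dualF_eqI; auto simp: Fcoeffs coeff_monom split: nat.split)+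

lemma left_a1_monom:
  "left_a1 \<omega> lam (monom (monom c r) s) = monom (monom c (Suc r)) s
     + monom (monom (- (fps_const (of_real lam) * (1 - Cw \<omega>)) * fps_deriv c) r) s"
  by (simp add: left_a1_def ops_monom minus_monom)

lemma left_a2_monom:
  "left_a2 \<omega> lam (monom (monom c r) s) = monom (monom c r) (Suc s)
     + monom (monom (- (fps_const (of_real lam) * of_nat r) * c) r) s
     + monom (monom (- (fps_const (of_real lam) * Sw \<omega>) * fps_deriv c) r) s"
  by (simp add: left_a2_def ops_monom minus_monom mult.assoc)

lemma left_a2_pow:
  "left_a2 \<omega> lam ((left_a1 \<omega> lam ^^ r) f) =
     (left_a1 \<omega> lam ^^ r) (left_a2 \<omega> lam f)
       + lcoef (- (fps_const (of_real lam) * of_nat r)) ((left_a1 \<omega> lam ^^ r) f)"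
proof (induction r)
  case (Suc r)
  have "lcoef (- (fps_const (of_real lam) * of_nat (Suc r))) h =
      lcoef (- (fps_const (of_real lam) * of_nat r)) h - cscale (of_real lam) h" for h
    by (intro dualF_eqI) (simp add: coeff_lcoef algebra_simps flip: fps_const_neg)
  then show ?case
    using Suc by (simp add: left_a12 add_ops lcoef_left_a1 del: of_nat_Suc)
qed simp

lemma Fmult_lcoef: "Fmult \<omega> lam (lcoef c f) g = lcoef c (Fmult \<omega> lam f g)"
  by (induction f rule: dualF_induct)
     (simp_all add: add_ops Fmult_add_left Fmult_monom ops_monom)

lemma Fmult_left_a1: "Fmult \<omega> lam (left_a1 \<omega> lam f) g = left_a1 \<omega> lam (Fmult \<omega> lam f g)"
  by (induction f rule: dualF_induct)
     (simp_all add: add_ops Fmult_add_left Fmult_monom left_a1_monom lcoef_left_a1)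

lemma Fmult_left_a2: "Fmult \<omega> lam (left_a2 \<omega> lam f) g = left_a2 \<omega> lam (Fmult \<omega> lam f g)"
  by (induction f rule: dualF_induct)
     (simp_all add: add_ops Fmult_add_left Fmult_monom left_a2_monom lcoef_left_a2
       left_a2_pow mult_ac)

lemma Fmult_pows:
  "Fmult \<omega> lam ((left_a1 \<omega> lam ^^ r) f) g = (left_a1 \<omega> lam ^^ r) (Fmult \<omega> lam f g)"
  "Fmult \<omega> lam ((left_a2 \<omega> lam ^^ r) f) g = (left_a2 \<omega> lam ^^ r) (Fmult \<omega> lam f g)"
  by (induction r) (simp_all add: Fmult_left_a1 Fmult_left_a2)

lemma Fmult_assoc:
  "Fmult \<omega> lam (Fmult \<omega> lam f g) h = Fmult \<omega> lam f (Fmult \<omega> lam g h)"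
  by (induction f rule: dualF_induct)
     (simp_all add: Fmult_add_left Fmult_monom Fmult_lcoef Fmult_pows)

lemma one_dualF: "1 = monom (monom 1 0) 0"
  by (simp add: monom_0 one_pCons)

lemma pow_one:
  "(left_a2 \<omega> lam ^^ s) 1 = monom (monom 1 0) s"
  "(left_a1 \<omega> lam ^^ r) (monom (monom 1 0) s) = monom (monom 1 r) s"
  subgoal by (induction s) (simp_all add: one_dualF left_a2_monom del: monom_eq_1)
  subgoal by (induction r) (simp_all add: left_a1_monom del: monom_eq_1)
  done

lemma Fmult_one: "Fmult \<omega> lam 1 f = f" "Fmult \<omega> lam f 1 = f"
  subgoal by (simp add: one_dualF Fmult_monom del: monom_eq_1)
  subgoal by (induction f rule: dualF_induct)
     (simp_all add: Fmult_add_left Fmult_monom pow_one ops_monom del: monom_eq_1)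
  done

lemma Frelations:
  "Fmult \<omega> lam (monoF 1 0 0) (monoF 0 1 0) - Fmult \<omega> lam (monoF 0 1 0) (monoF 1 0 0) =
     lcoef (fps_const (of_real lam) * (1 - Cw \<omega>)) 1"
  "Fmult \<omega> lam (monoF 1 0 0) (monoF 0 0 1) - Fmult \<omega> lam (monoF 0 0 1) (monoF 1 0 0) =
     lcoef (fps_const (of_real lam) * Sw \<omega>) 1"
  "Fmult \<omega> lam (monoF 0 1 0) (monoF 0 0 1) - Fmult \<omega> lam (monoF 0 0 1) (monoF 0 1 0) =
     cscale (of_real lam) (monoF 0 1 0)"
  unfolding one_dualF
  by (simp_all add: monoF_def Fmult_monom left_a1_monom left_a2_monom ops_monom minus_monom flip: fps_const_neg
      del: monom_eq_1)

lemma dphi_const: "(\<And>r s. \<exists>c. coeff (coeff f s) r = fps_const c) \<Longrightarrow> dphi f = 0"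
  by (intro dualF_eqI) (metis coeff_0 coeff_dphi fps_deriv_const)

lemma Aalg_eq:
  "Aalg \<omega> lam = {f. \<forall>r s. \<exists>c. coeff (coeff f s) r = fps_const c}" 
proof -
  define K :: "dualF set" where "K = {f. \<forall>r s. \<exists>c. coeff (coeff f s) r = fps_const c}"
  have K1: "left_a1 \<omega> lam f \<in> K" if "f \<in> K" for f
  proof -
    have "dphi f = 0" using that dphi_const[of f] by (auto simp: K_def)
    then have "\<exists>c. coeff (coeff (left_a1 \<omega> lam f) s) r = fps_const c" for r s
      using that fps_const_0_eq_0[symmetric]
      by (cases r) (auto simp: K_def left_a1_def coeff_abar1)
    then show ?thesis unfolding K_def by blast
  qed
  have K2: "left_a2 \<omega> lam f \<in> K" if "f \<in> K" for f
  proof -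
    define e where "e r s = (SOME c. coeff (coeff f s) r = fps_const c)" for r s
    have e: "coeff (coeff f s) r = fps_const (e r s)" for r s
      unfolding e_def by (rule someI_ex) (use that in \<open>auto simp: K_def\<close>)
    have "dphi f = 0" using that dphi_const[of f] by (auto simp: K_def)
    then have "coeff (coeff (left_a2 \<omega> lam f) s) r =
        fps_const ((case s of 0 \<Rightarrow> 0 | Suc s' \<Rightarrow> e r s') - of_real lam * (of_nat r * e r s))" for r s
      by (simp add: left_a2_def Fcoeffs e fps_of_nat[symmetric] del: fps_of_nat of_nat_Suc split: nat.split)
    then show ?thesis unfolding K_def by blast
  qed
  have Kadd: "f + g \<in> K" if "f \<in> K" "g \<in> K" for f g
  proof -
    have "\<exists>c. coeff (coeff (f + g) s) r = fps_const c" for r s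
      using that by (simp add: K_def) (metis fps_const_add)
    then show ?thesis unfolding K_def by blast
  qed
  have Kscale: "lcoef d f \<in> K" if "f \<in> K" "d = fps_const c" for d f c
  proof -
    have "\<exists>c. coeff (coeff (lcoef d f) s) r = fps_const c" for r s
      using that by (simp add: coeff_lcoef K_def) (metis fps_const_mult)
    then show ?thesis unfolding K_def by blast
  qed
  have K0: "0 \<in> K" by (auto simp: K_def intro: exI[of _ 0])
  have Ksum: "(\<Sum>i\<in>A. F i) \<in> K" if "finite A" "\<And>i. i \<in> A \<Longrightarrow> F i \<in> K"
    for A :: "nat set" and F
    using that
  proof (induction A)
    case empty then show ?case using K0 by simp
  next
    case (insert x A)
    then have "F x + (\<Sum>i\<in>A. F i) \<in> K" by (intro Kadd) auto
    with insert show ?case by simp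
  qed
  have Kpow: "(left_a1 \<omega> lam ^^ r) ((left_a2 \<omega> lam ^^ s) f) \<in> K" if "f \<in> K" for f r s
  proof (induction r)
    case 0
    show ?case by (induction s) (use that K2 in auto)
  qed (use K1 in auto)
  have Kmonom: "monom (monom (fps_const c) r) s \<in> K" for c r s
  proof -
    have "coeff (coeff (monom (monom (fps_const c) r) s) s') r' =
        fps_const (if s' = s \<and> r' = r then c else 0)" for r' s'
      by (simp add: coeff_monom)
    then show ?thesis unfolding K_def by blast
  qed
  have AK: "Aalg \<omega> lam \<subseteq> K"
  proof
    fix f assume "f \<in> Aalg \<omega> lam"
    then show "f \<in> K"
    proof induction
      case one
      show ?case using Kmonom[of 1 0 0] by simp
    next
      case a1
      show ?case using Kmonom[of 1 1 0] by (simp add: monoF_def)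
    next
      case a2
      show ?case using Kmonom[of 1 0 1] by (simp add: monoF_def)
    next
      case (scale f c)
      from Kscale[OF scale.IH refl] show ?case .
    next
      case (add f g)
      from Kadd[OF add.IH] show ?case .
    next
      case (mult f g)
      show ?case unfolding Fmult_def
      proof (intro Ksum finite_atMost)
        fix s r
        obtain c where "coeff (coeff f s) r = fps_const c" using mult.IH(1) unfolding K_def by blast
        from Kscale[OF Kpow[OF mult.IH(2)] this]
        show "lcoef (coeff (coeff f s) r) ((left_a1 \<omega> lam ^^ r) ((left_a2 \<omega> lam ^^ s) g)) \<in> K" .
      qed
    qed
  qed
  have A2: "(left_a2 \<omega> lam ^^ s) 1 \<in> Aalg \<omega> lam" for s
  proof (induction s)
    case (Suc s)
    from Aalg.mult[OF Aalg.a2 this] show ?case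
      by (simp add: monoF_def Fmult_monom del: monom_eq_1)
  qed (simp add: Aalg.one)
  have A1: "(left_a1 \<omega> lam ^^ r) ((left_a2 \<omega> lam ^^ s) 1) \<in> Aalg \<omega> lam" for r s
  proof (induction r)
    case (Suc r)
    from Aalg.mult[OF Aalg.a1 this] show ?case
      by (simp add: monoF_def Fmult_monom del: monom_eq_1)
  qed (simp add: A2)
  have A0: "0 \<in> Aalg \<omega> lam" using Aalg.scale[OF Aalg.one, where c = 0] by simp
  have Asum: "(\<Sum>i\<in>A. F i) \<in> Aalg \<omega> lam" if "finite A" "\<And>i. i \<in> A \<Longrightarrow> F i \<in> Aalg \<omega> lam"
    for A :: "nat set" and F
    using that by (induction A) (auto intro: A0 Aalg.add)
  have KA: "K \<subseteq> Aalg \<omega> lam"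
  proof
    fix f assume f: "f \<in> K"
    have "f = Fmult \<omega> lam f 1" by (simp add: Fmult_one)
    also have "\<dots> \<in> Aalg \<omega> lam"
      unfolding Fmult_def
    proof (intro Asum finite_atMost)
      fix s r
      obtain c where "coeff (coeff f s) r = fps_const c" using f unfolding K_def by blast
      with Aalg.scale[OF A1]
      show "lcoef (coeff (coeff f s) r) ((left_a1 \<omega> lam ^^ r) ((left_a2 \<omega> lam ^^ s) 1)) \<in> Aalg \<omega> lam"
        by metis
    qed
    finally show "f \<in> Aalg \<omega> lam" .
  qed
  from AK KA have "Aalg \<omega> lam = K" by (rule subset_antisym)
  then show ?thesis unfolding K_def .
qed


section \<open>The pairing and the left regular action\<close>

definition pairing :: "hopf \<Rightarrow> dualF \<Rightarrow> complex" where
  "pairing h f =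
     (\<Sum>m\<le>degree h. \<Sum>s\<le>degree f. \<Sum>r\<le>degree (coeff f s).
        fact m * fps_nth (coeff (coeff f s) r) m * (d1 ^^ r) ((d2 ^^ s) (coeff h m)) 0 0)"

definition is_left_regular :: "real \<Rightarrow> real \<Rightarrow> hopf \<Rightarrow> dualF \<Rightarrow> dualF \<Rightarrow> bool" where
  "is_left_regular \<omega> lam h f g \<longleftrightarrow>
     (\<forall>h'\<in>Halg lam. pairing h' g = pairing (Hmult \<omega> lam h' h) f)"

definition left_regular :: "real \<Rightarrow> real \<Rightarrow> hopf \<Rightarrow> dualF \<Rightarrow> dualF" where
  "left_regular \<omega> lam h f = (THE g. is_left_regular \<omega> lam h f g)"

definition restr_regular :: "real \<Rightarrow> real \<Rightarrow> hopf \<Rightarrow> dualF \<Rightarrow> dualF" where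
  "restr_regular \<omega> lam h = restrict (left_regular \<omega> lam h) (Aalg \<omega> lam)"

end

theory Submission
  imports Defs
begin

text \<open>
  The pairing is determined by its restriction to \<open>\<L>\<close>, which reads off the Taylor jet of \<open>l\<close> at the
  origin: \<open>\<langle>l + J h, f\<rangle> = \<langle>l, f\<rangle> + \<langle>h, \<partial>\<^sub>\<phi> f\<rangle>\<close>. Under this restricted pairing, multiplication by
  \<open>P\<^sub>i\<close> and \<open>e\<^bsup>tP\<^sub>2\<^esup>\<close> is transposed to the derivative in \<open>a\<^sub>i\<close> and to \<open>e\<^bsup>t\<partial>\<^esup>\<close> with \<open>\<partial>\<close> the derivative
  in \<open>a\<^sub>2\<close>, and the partial derivatives of \<open>l\<close> to multiplication by \<open>a\<^sub>1\<close>, \<open>a\<^sub>2\<close>. Since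
  \<open>l J = J l + Jhat l\<close>, the action of \<open>J\<close> is \<open>\<partial>\<^sub>\<phi>\<close> plus the transpose of \<open>Jhat\<close>. Every action commutes
  with \<open>\<partial>\<^sub>\<phi>\<close>, and the span of the ordered monomials \<open>a\<^sub>1\<^sup>r a\<^sub>2\<^sup>s\<close> is the kernel of \<open>\<partial>\<^sub>\<phi>\<close>, so it is stable.
\<close>

section \<open>The pairing of functions with normally ordered expressions\<close>

text \<open>The derivations stand in the same order as in \<open>pairing\<close>, so
  \<open>pairing\<close> is a combination of jets by folding this definition.\<close>

definition jet :: "nat \<Rightarrow> nat \<Rightarrow> fun2 \<Rightarrow> complex" where
  "jet r s l = (d1 ^^ r) ((d2 ^^ s) l) 0 0"

text \<open>The part of \<open>pairing\<close> belonging to the zeroth power of J: only the constant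
  terms of the coefficient series in \<phi> contribute.\<close>

definition jet_pair :: "fun2 \<Rightarrow> dualF \<Rightarrow> complex" where
  "jet_pair l f =
     (\<Sum>s\<le>degree f. \<Sum>r\<le>degree (coeff f s). fps_nth (coeff (coeff f s) r) 0 * jet r s l)"

section \<open>Partial derivatives and jets on \<open>Lalg\<close>\<close>

lemma d_zero [simp]: "d1 0 = 0" "d2 0 = 0"
  using d_basic(1,2)[of 0] by (simp_all add: zero_fun_def)

lemma d_scale:
  assumes "l \<in> Lalg lam"
  shows "d1 ((\<lambda>x y. c) * l) = (\<lambda>x y. c) * d1 l" "d2 ((\<lambda>x y. c) * l) = (\<lambda>x y. c) * d2 l"
  by (simp_all only: d_mult[OF Lalg.const assms] d_basic mult_zero_left add_0_right)

text \<open>The mixed derivatives agree on the generators, and the Leibniz rule carries this through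
  sums and products.\<close>

lemma d1_d2_commute: "l \<in> Lalg lam \<Longrightarrow> d1 (d2 l) = d2 (d1 l)"
proof (induction rule: Lalg.induct)
  case exp_pos
  show ?case by (simp only: d_basic d_zero)
next
  case exp_neg
  show ?case using d_basic(8)[of "- lam"] by (simp add: d_basic)
next
  case (add l l')
  then show ?case by (simp only: d_add d_add[OF Lalg_d(1) Lalg_d(1)] d_add[OF Lalg_d(2) Lalg_d(2)])
next
  case (mult l l')
  note l = mult.hyps(1) mult.hyps(2)
  show ?case
    unfolding d_mult[OF l] d_add[OF Lalg.mult[OF l(1) Lalg_d(2)[OF l(2)]] Lalg.mult[OF Lalg_d(2)[OF l(1)] l(2)]]
      d_add[OF Lalg.mult[OF l(1) Lalg_d(1)[OF l(2)]] Lalg.mult[OF Lalg_d(1)[OF l(1)] l(2)]]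
      d_mult[OF l(1) Lalg_d(1)[OF l(2)]] d_mult[OF l(1) Lalg_d(2)[OF l(2)]]
      d_mult[OF Lalg_d(1)[OF l(1)] l(2)] d_mult[OF Lalg_d(2)[OF l(1)] l(2)] mult.IH
    by (simp only: add_ac)
next
  case P1
  show ?case using d_basic(1,2)[of 1] by (simp add: d_basic one_fun_def)
next
  case P2
  show ?case using d_basic(1,2)[of 1] by (simp add: d_basic one_fun_def)
qed (simp only: d_basic d_zero)

lemma Lalg_d_pow:
  assumes "l \<in> Lalg lam" shows "(d1 ^^ r) l \<in> Lalg lam" "(d2 ^^ r) l \<in> Lalg lam"
  using assms by (induction r) (simp_all add: Lalg_d)

lemma d_pow_linear:
  assumes "l \<in> Lalg lam" "l' \<in> Lalg lam"
  shows "(d1 ^^ r) (l + l') = (d1 ^^ r) l + (d1 ^^ r) l'"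
    "(d2 ^^ r) (l + l') = (d2 ^^ r) l + (d2 ^^ r) l'"
    "(d1 ^^ r) ((\<lambda>x y. c) * l) = (\<lambda>x y. c) * (d1 ^^ r) l"
    "(d2 ^^ r) ((\<lambda>x y. c) * l) = (\<lambda>x y. c) * (d2 ^^ r) l"
  using assms
  by (induction r) (simp_all add: d_add[of _ lam] d_scale[of _ lam] Lalg_d_pow del: plus_fun_apply times_fun_apply)

lemma d_pow_zero: "(d1 ^^ r) 0 = 0" "(d2 ^^ r) 0 = 0"
  by (induction r) simp_all

lemma jet_zero [simp]: "jet r s 0 = 0"
  by (simp add: jet_def d_pow_zero)

lemma jet_linear:
  assumes "l \<in> Lalg lam" "l' \<in> Lalg lam"
  shows "jet r s (l + l') = jet r s l + jet r s l'" "jet r s ((\<lambda>x y. c) * l) = c * jet r s l"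
  using assms by (simp_all add: jet_def d_pow_linear[of _ lam] Lalg_d_pow)

text \<open>In \<open>jet\<close> the powers of \<open>d2\<close> act first, so an inner
  \<open>d1\<close> must be commuted past them, whereas an inner \<open>d2\<close> merely raises
  their number.\<close>

lemma jet_d:
  assumes "l \<in> Lalg lam"
  shows "jet r s (d1 l) = jet (Suc r) s l" "jet r s (d2 l) = jet r (Suc s) l"
proof -
  have "(d2 ^^ s) (d1 l) = d1 ((d2 ^^ s) l)"
    using assms by (induction s) (simp_all add: d1_d2_commute[of _ lam] Lalg_d_pow)
  then show "jet r s (d1 l) = jet (Suc r) s l"
    by (simp add: jet_def funpow_swap1)
qed (simp add: jet_def funpow_swap1)

section \<open>Recursion and bilinearity of the pairings\<close>

text \<open>The ranges in the definition depend on f; a common rectangle of indices makes the sums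
  for different f comparable.\<close>

lemma jet_pair_bound:
  assumes "degree f \<le> N" "\<And>s. degree (coeff f s) \<le> M"
  shows "jet_pair l f = (\<Sum>s\<le>N. \<Sum>r\<le>M. fps_nth (coeff (coeff f s) r) 0 * jet r s l)"
proof -
  have "jet_pair l f = (\<Sum>s\<le>degree f. \<Sum>r\<le>M. fps_nth (coeff (coeff f s) r) 0 * jet r s l)"
    unfolding jet_pair_def
    by (intro sum.cong[OF refl] sum.mono_neutral_left)
       (use assms(2) in \<open>auto simp: coeff_eq_0\<close>)
  also have "\<dots> = (\<Sum>s\<le>N. \<Sum>r\<le>M. fps_nth (coeff (coeff f s) r) 0 * jet r s l)"
    by (intro sum.mono_neutral_left) (use assms(1) in \<open>auto simp: coeff_eq_0\<close>)
  finally show ?thesis .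
qed

lemma pairing_bound:
  assumes "degree h \<le> K" "degree f \<le> N" "\<And>s. degree (coeff f s) \<le> M"
  shows "pairing h f = (\<Sum>m\<le>K. \<Sum>s\<le>N. \<Sum>r\<le>M.
    fact m * fps_nth (coeff (coeff f s) r) m * jet r s (coeff h m))"
proof -
  have "pairing h f = (\<Sum>m\<le>degree h. \<Sum>s\<le>degree f. \<Sum>r\<le>M.
    fact m * fps_nth (coeff (coeff f s) r) m * jet r s (coeff h m))"
    unfolding pairing_def jet_def[symmetric]
    by (intro sum.cong[OF refl] sum.mono_neutral_left)
       (use assms(3) in \<open>auto simp: coeff_eq_0\<close>)
  also have "\<dots> = (\<Sum>m\<le>degree h. \<Sum>s\<le>N. \<Sum>r\<le>M.
    fact m * fps_nth (coeff (coeff f s) r) m * jet r s (coeff h m))"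
    by (intro sum.cong[OF refl] sum.mono_neutral_left) (use assms(2) in \<open>auto simp: coeff_eq_0\<close>)
  also have "\<dots> = (\<Sum>m\<le>K. \<Sum>s\<le>N. \<Sum>r\<le>M.
    fact m * fps_nth (coeff (coeff f s) r) m * jet r s (coeff h m))"
    by (intro sum.mono_neutral_left) (use assms(1) in \<open>auto simp: coeff_eq_0\<close>)
  finally show ?thesis .
qed

lemma degree_dphi: "degree (dphi f) \<le> degree f" "degree (coeff (dphi f) s) \<le> degree (coeff f s)"
  by (rule degree_le; simp add: coeff_dphi coeff_eq_0 dphi_def coeff_map_poly map_poly_0)+

lemma pairing_zero [simp]: "pairing 0 f = 0"
  by (simp add: pairing_def flip: jet_def)

text \<open>(m+1)! times a coefficient of index m+1 is m! times the coefficient of index m of the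
  derivative. Hence removing one J on the left differentiates f in \<phi>; inductions on h rest on
  this.\<close>

lemma pairing_pCons: "pairing (pCons l h) f = jet_pair l f + pairing h (dphi f)"
proof -
  obtain M where M: "\<And>s. degree (coeff f s) \<le> M" using inner_degree_bound by metis
  let ?N = "degree f"
  have M': "degree (coeff (dphi f) s) \<le> M" for s
    using M degree_dphi(2) order_trans by blast
  have "pairing (pCons l h) f = (\<Sum>m\<le>Suc (degree h). \<Sum>s\<le>?N. \<Sum>r\<le>M.
      fact m * fps_nth (coeff (coeff f s) r) m * jet r s (coeff (pCons l h) m))"
    by (rule pairing_bound) (simp_all add: degree_pCons_le M)
  also have "\<dots> = jet_pair l f + (\<Sum>m\<le>degree h. \<Sum>s\<le>?N. \<Sum>r\<le>M.
      fact m * fps_nth (coeff (coeff (dphi f) s) r) m * jet r s (coeff h m))"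
    by (subst sum.atMost_Suc_shift)
       (simp add: jet_pair_bound[OF order_refl M] coeff_dphi mult_ac del: of_nat_Suc)
  also have "(\<Sum>m\<le>degree h. \<Sum>s\<le>?N. \<Sum>r\<le>M.
      fact m * fps_nth (coeff (coeff (dphi f) s) r) m * jet r s (coeff h m)) = pairing h (dphi f)"
    by (rule pairing_bound[OF order_refl degree_dphi(1) M', symmetric])
  finally show ?thesis .
qed

lemma jet_pair_add_right: "jet_pair l (f + g) = jet_pair l f + jet_pair l g"
proof -
  obtain M M' where M: "\<And>s. degree (coeff f s) \<le> M" "\<And>s. degree (coeff g s) \<le> M'"
    using inner_degree_bound by metis
  let ?M = "max M M'" and ?N = "max (degree f) (degree g)"
  have d: "degree (coeff (f + g) s) \<le> ?M" for s
    using M[of s] by (simp) (meson degree_add_le max.cobounded1 max.cobounded2 order_trans)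
  have "degree (f + g) \<le> ?N" by (simp add: degree_add_le)
  from jet_pair_bound[OF this d] show ?thesis
    using jet_pair_bound[of f ?N ?M l] jet_pair_bound[of g ?N ?M l] M
    by (simp add: le_max_iff_disj sum.distrib distrib_right)
qed

lemma jet_pair_monom: "jet_pair l (monom (monom c r) s) = fps_nth c 0 * jet r s l"
proof -
  have "jet_pair l (monom (monom c r) s) = (\<Sum>s'\<le>s. \<Sum>r'\<le>r.
      if s' = s then if r' = r then fps_nth c 0 * jet r s l else 0 else 0)"
    by (subst jet_pair_bound[of _ s r])
       (auto simp: degree_monom_le coeff_monom intro!: sum.cong)
  also have "\<dots> = (\<Sum>s'\<le>s. if s' = s then
      (\<Sum>r'\<le>r. if r' = r then fps_nth c 0 * jet r s l else 0) else 0)"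
    by (intro sum.cong) auto
  finally show ?thesis by simp
qed

lemma jet_pair_zero [simp]: "jet_pair 0 f = 0" "jet_pair l 0 = 0"
  by (simp_all add: jet_pair_def)

lemma jet_pair_linear:
  assumes "l \<in> Lalg lam" "l' \<in> Lalg lam"
  shows "jet_pair (l + l') f = jet_pair l f + jet_pair l' f"
    "jet_pair ((\<lambda>x y. c) * l) f = c * jet_pair l f"
  using assms
  by (simp_all add: jet_pair_def jet_linear[of _ lam] distrib_left sum.distrib sum_distrib_left
      mult.left_commute del: plus_fun_apply times_fun_apply)

lemma jet_pair_scale: "jet_pair l (cscale c f) = c * jet_pair l f"
  by (induction f rule: dualF_induct)
     (simp_all add: add_ops jet_pair_add_right jet_pair_monom ops_monom distrib_left mult.assoc)

lemma jet_pair_minus: "jet_pair l (- f) = - jet_pair l f"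
  using jet_pair_add_right[of l f "- f"] by (simp add: eq_neg_iff_add_eq_0 add.commute)

lemma jet_pair_diff: "jet_pair l (f - g) = jet_pair l f - jet_pair l g"
  using jet_pair_add_right[of l f "- g"] by (simp add: jet_pair_minus)

lemma jet_pair_d:
  assumes "l \<in> Lalg lam"
  shows "jet_pair (d1 l) f = jet_pair l (abar1 f)" "jet_pair (d2 l) f = jet_pair l (abar2 f)"
  using assms
  by (induction f rule: dualF_induct)
     (simp_all add: add_ops jet_pair_add_right jet_pair_monom ops_monom jet_d[of _ lam])


text \<open>Starting from series in \<phi>, every expression is reached by sums and by
  \<open>abar1\<close> and \<open>abar2\<close>. These two are the transposes of \<open>d1\<close>
  and \<open>d2\<close>, so each induction step becomes an instance of the Leibniz rule.\<close>

lemma dualF_gen_induct [case_names const add abar1 abar2]: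
  assumes "\<And>c. P (monom (monom c 0) 0)" "\<And>f g. P f \<Longrightarrow> P g \<Longrightarrow> P (f + g)"
    "\<And>f. P f \<Longrightarrow> P (abar1 f)" "\<And>f. P f \<Longrightarrow> P (abar2 f)"
  shows "P (f :: dualF)"
proof (induction f rule: dualF_induct)
  case (monom c r s)
  have "P (monom (monom c 0) s)" for s
    using assms(1) by (induction s) (simp_all flip: ops_monom(3) add: assms(4))
  then show ?case by (induction r) (simp_all flip: ops_monom(2) add: assms(3))
qed (rule assms(2))

section \<open>Transposes under the pairing\<close>

lemma coeff_da2: "coeff (coeff (da2 f) s) r = of_nat (Suc s) * coeff (coeff f (Suc s)) r"
  by (simp add: da2_def coeff_pderiv of_nat_poly del: of_nat_Suc)

text \<open>The Weyl algebra relations, which mirror the Leibniz rule for products with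
  \<open>P1\<close> and \<open>P2\<close>.\<close>

lemma da_abar:
  "da1 (abar1 f) = f + abar1 (da1 f)" "da1 (abar2 f) = abar2 (da1 f)"
  "da2 (abar1 f) = abar1 (da2 f)" "da2 (abar2 f) = f + abar2 (da2 f)"
  "da2 (f + g) = da2 f + da2 g" "da2 (lcoef c f) = lcoef c (da2 f)"
  by (intro dualF_eqI; simp add: Fcoeffs coeff_da2 algebra_simps split: nat.split)+

lemma dphi_commute:
  "dphi (abar1 f) = abar1 (dphi f)" "dphi (abar2 f) = abar2 (dphi f)"
  "dphi (da1 f) = da1 (dphi f)" "dphi (da2 f) = da2 (dphi f)"
  "dphi (cscale c f) = cscale c (dphi f)" "dphi (f - g) = dphi f - dphi g"
  by (intro dualF_eqI; simp add: Fcoeffs coeff_da2 algebra_simps split: nat.split)+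

lemma da_const: "da1 (monom (monom c 0) 0) = 0" "da2 (monom (monom c 0) 0) = 0"
  by (intro dualF_eqI; simp add: Fcoeffs coeff_da2 coeff_monom)+

text \<open>At the base both sides vanish, since \<open>P1\<close> is zero at the origin. In the
  step for \<open>abar1\<close> the Leibniz term l matches the commutator of \<open>da1\<close> with
  \<open>abar1\<close>; l varies because it is replaced by its derivatives.\<close>

lemma jet_pair_P1: "l \<in> Lalg lam \<Longrightarrow> jet_pair (P1 * l) f = jet_pair l (da1 f)"
proof (induction f arbitrary: l rule: dualF_gen_induct)
  case (const c)
  show ?case by (simp add: da_const jet_pair_monom jet_def P1_def)
next
  case (abar1 f)
  have "d1 (P1 * l) = l + P1 * d1 l"
    using d_mult(1)[OF Lalg.P1 abar1.prems] d_basic(3) by (simp only: mult_1_left add.commute)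
  with abar1 show ?case
    by (simp add: da_abar jet_pair_add_right Lalg.mult Lalg.P1 Lalg_d jet_pair_linear[of _ lam]
        del: plus_fun_apply times_fun_apply flip: jet_pair_d[of _ lam])
next
  case (abar2 f)
  have "d2 (P1 * l) = P1 * d2 l"
    using d_mult(2)[OF Lalg.P1 abar2.prems] d_basic(4) by (simp only: mult_zero_left add_0_right)
  with abar2 show ?case
    by (simp add: da_abar Lalg.mult Lalg.P1 Lalg_d
        del: plus_fun_apply times_fun_apply flip: jet_pair_d[of _ lam])
qed (simp_all add: add_ops jet_pair_add_right)

lemma jet_pair_P2: "l \<in> Lalg lam \<Longrightarrow> jet_pair (P2 * l) f = jet_pair l (da2 f)"
proof (induction f arbitrary: l rule: dualF_gen_induct)
  case (const c)
  show ?case by (simp add: da_const jet_pair_monom jet_def P2_def)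
next
  case (abar1 f)
  have "d1 (P2 * l) = P2 * d1 l"
    using d_mult(1)[OF Lalg.P2 abar1.prems] d_basic(5) by (simp only: mult_zero_left add_0_right)
  with abar1 show ?case
    by (simp add: da_abar Lalg.mult Lalg.P2 Lalg_d
        del: plus_fun_apply times_fun_apply flip: jet_pair_d[of _ lam])
next
  case (abar2 f)
  have "d2 (P2 * l) = l + P2 * d2 l"
    using d_mult(2)[OF Lalg.P2 abar2.prems] d_basic(6) by (simp only: mult_1_left add.commute)
  with abar2 show ?case
    by (simp add: da_abar jet_pair_add_right Lalg.mult Lalg.P2 Lalg_d jet_pair_linear[of _ lam]
        del: plus_fun_apply times_fun_apply flip: jet_pair_d[of _ lam])
qed (simp_all add: da_abar jet_pair_add_right)

section \<open>The exponential of the derivative in the second generator\<close>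

text \<open>Powers of \<open>da2\<close> beyond the degree vanish, so the formal sum is finite;
  leaving N free lets several expressions share one range.\<close>

lemma exp_da2_bound:
  assumes "degree f \<le> N"
  shows "exp_da2 t f = (\<Sum>k\<le>N. cscale (t ^ k / fact k) ((da2 ^^ k) f))"
proof -
  have "(da2 ^^ k) f = 0" if "degree f < k" for k
    using that unfolding da2_def[abs_def]
    by (intro poly_eqI) (simp add: coeff_higher_pderiv coeff_eq_0)
  then have "k \<le> N" if "cscale (t ^ k / fact k) ((da2 ^^ k) f) \<noteq> 0" for k
    using that assms by (metis lcoef_simps(2) le_less_trans not_le)
  then show ?thesis
    unfolding exp_da2_def by (intro Sum_any.expand_superset) auto
qed

lemma da2_pow:
  "(da2 ^^ k) (f + g) = (da2 ^^ k) f + (da2 ^^ k) g"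
  "(da2 ^^ k) (abar1 f) = abar1 ((da2 ^^ k) f)"
  "(da2 ^^ k) (dphi f) = dphi ((da2 ^^ k) f)"
  by (induction k) (simp_all add: da_abar dphi_commute)

text \<open>The commutator of a power of a derivation with its variable, stated for successors so
  that the lowered exponent is k.\<close>

lemma da2_pow_Suc_abar2:
  "(da2 ^^ Suc k) (abar2 f) = abar2 ((da2 ^^ Suc k) f) + cscale (of_nat (Suc k)) ((da2 ^^ k) f)"
proof (induction k)
  case (Suc k)
  have "(da2 ^^ Suc (Suc k)) (abar2 f) = da2 ((da2 ^^ Suc k) (abar2 f))" by simp
  also have "\<dots> = abar2 ((da2 ^^ Suc (Suc k)) f) + ((da2 ^^ Suc k) f + cscale (of_nat (Suc k)) ((da2 ^^ Suc k) f))"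
    unfolding Suc.IH by (simp add: da_abar del: of_nat_Suc)
  also have "(da2 ^^ Suc k) f + cscale (of_nat (Suc k)) ((da2 ^^ Suc k) f) = cscale (of_nat (Suc (Suc k))) ((da2 ^^ Suc k) f)"
    by (intro dualF_eqI) (simp add: Fcoeffs algebra_simps flip: fps_const_add)
  finally show ?case .
qed (simp add: da_abar)

lemma ops_zero: "abar1 0 = 0" "abar2 0 = 0" "dphi 0 = 0" "da1 0 = 0" "da2 0 = 0"
  by (intro dualF_eqI; simp add: Fcoeffs coeff_da2 split: nat.split)+

lemma ops_sum:
  "abar1 (sum F A) = (\<Sum>i\<in>A. abar1 (F i))" "abar2 (sum F A) = (\<Sum>i\<in>A. abar2 (F i))"
  "dphi (sum F A) = (\<Sum>i\<in>A. dphi (F i))" "lcoef c (sum F A) = (\<Sum>i\<in>A. lcoef c (F i))"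
  by (induction A rule: infinite_finite_induct; simp add: ops_zero add_ops)+

lemma lcoef_commute: "abar1 (lcoef c f) = lcoef c (abar1 f)" "abar2 (lcoef c f) = lcoef c (abar2 f)"
  by (intro dualF_eqI; simp add: Fcoeffs split: nat.split)+

lemma exp_da2_add: "exp_da2 t (f + g) = exp_da2 t f + exp_da2 t g"
  using exp_da2_bound[of "f + g" "max (degree f) (degree g)" t]
    exp_da2_bound[of f "max (degree f) (degree g)" t] exp_da2_bound[of g "max (degree f) (degree g)" t]
  by (simp add: degree_add_le da2_pow add_ops sum.distrib)

lemma exp_da2_abar1: "exp_da2 t (abar1 f) = abar1 (exp_da2 t f)"
proof -
  have "degree (abar1 f) \<le> degree f" by (simp add: abar1_def)
  from exp_da2_bound[OF this] exp_da2_bound[OF order_refl, of t f] show ?thesis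
    by (simp add: ops_sum da2_pow lcoef_commute)
qed

lemma dphi_exp_da2: "dphi (exp_da2 t f) = exp_da2 t (dphi f)"
  using exp_da2_bound[OF degree_dphi(1), of t f] exp_da2_bound[OF order_refl, of t f]
  by (simp add: ops_sum da2_pow dphi_commute)

lemma exp_da2_const: "exp_da2 t (monom (monom c 0) 0) = monom (monom c 0) 0"
  by (subst exp_da2_bound[of _ 0]) (simp_all add: monom_0)

text \<open>The exponential shifts the variable by t: the commutators of the single powers, weighted
  by the coefficients of the series, sum to t times the series.\<close>

lemma exp_da2_abar2: "exp_da2 t (abar2 f) = abar2 (exp_da2 t f) + cscale t (exp_da2 t f)"
proof -
  let ?c = "\<lambda>k. t ^ k / fact k" and ?N = "degree f"
  have c: "?c (Suc k) * of_nat (Suc k) = t * ?c k" for k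
    by (simp add: field_simps del: of_nat_Suc)
  \<comment> \<open>\<open>abar2\<close> may raise the degree by one, hence the longer range; the
    term k = 0 is then split off because the commutator formula covers successors only.\<close>
  have "exp_da2 t (abar2 f) = (\<Sum>k\<le>Suc ?N. cscale (?c k) ((da2 ^^ k) (abar2 f)))"
    by (rule exp_da2_bound) (simp add: abar2_def degree_pCons_le)
  also have "\<dots> = abar2 f + (\<Sum>k\<le>?N. cscale (?c (Suc k)) ((da2 ^^ Suc k) (abar2 f)))"
    by (subst sum.atMost_Suc_shift) simp
  also have "\<dots> = abar2 f + (\<Sum>k\<le>?N. abar2 (cscale (?c (Suc k)) ((da2 ^^ Suc k) f)))
      + (\<Sum>k\<le>?N. cscale (?c (Suc k) * of_nat (Suc k)) ((da2 ^^ k) f))"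
    unfolding da2_pow_Suc_abar2 add_ops lcoef_simps lcoef_commute sum.distrib fps_const_mult
    by (simp only: add.assoc)
  also have "abar2 f + (\<Sum>k\<le>?N. abar2 (cscale (?c (Suc k)) ((da2 ^^ Suc k) f)))
      = (\<Sum>k\<le>Suc ?N. abar2 (cscale (?c k) ((da2 ^^ k) f)))"
    by (subst sum.atMost_Suc_shift) simp
  also have "\<dots> = abar2 (exp_da2 t f)"
    by (subst exp_da2_bound[of f "Suc ?N"]) (simp_all only: ops_sum le_Suc_eq order_refl simp_thms)
  also have "(\<Sum>k\<le>?N. cscale (?c (Suc k) * of_nat (Suc k)) ((da2 ^^ k) f)) = cscale t (exp_da2 t f)"
    unfolding c exp_da2_bound[OF order_refl, of t f] ops_sum by simp
  finally show ?thesis .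
qed

text \<open>The parameter t is kept free because \<open>Jhat\<close> involves -2 \<open>lam\<close>
  besides the exponents \<open>lam\<close> and -\<open>lam\<close> of the generators.\<close>

definition expP2 :: "real \<Rightarrow> fun2" where
  "expP2 t = (\<lambda>x y. exp (complex_of_real (t * y)))"

text \<open>The base case holds because the exponential is 1 at the origin. In the step for
  \<open>abar2\<close>, differentiating the exponential yields the factor t that the shift rule
  produces on the other side.\<close>

lemma jet_pair_expP2:
  assumes E: "expP2 t \<in> Lalg lam"
  shows "l \<in> Lalg lam \<Longrightarrow> jet_pair (expP2 t * l) f = jet_pair l (exp_da2 (of_real t) f)"
proof (induction f arbitrary: l rule: dualF_gen_induct)
  case (const c)
  show ?case by (simp add: exp_da2_const jet_pair_monom jet_def expP2_def)
next
  case (abar1 f)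
  have "d1 (expP2 t) = 0" unfolding expP2_def by (rule d_basic(7))
  then have "d1 (expP2 t * l) = expP2 t * d1 l"
    using d_mult(1)[OF E abar1.prems] by (simp only: mult_zero_left add_0_right)
  with abar1 show ?case
    by (simp add: exp_da2_abar1 E Lalg.mult Lalg_d
        del: plus_fun_apply times_fun_apply flip: jet_pair_d[of _ lam])
next
  case (abar2 f)
  have "d2 (expP2 t) = (\<lambda>x y. of_real t) * expP2 t"
    unfolding expP2_def d_basic(8) by (simp add: fun_eq_iff)
  then have "d2 (expP2 t * l) = expP2 t * d2 l + (\<lambda>x y. of_real t) * (expP2 t * l)"
    using d_mult(2)[OF E abar2.prems] by (simp only: mult.assoc)
  with abar2 show ?case
    by (simp add: exp_da2_abar2 jet_pair_add_right jet_pair_scale E Lalg.mult Lalg.const Lalg_d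
        jet_pair_linear[of _ lam] del: plus_fun_apply times_fun_apply flip: jet_pair_d[of _ lam])
qed (simp_all add: exp_da2_add jet_pair_add_right)

section \<open>The left regular action\<close>

lemma pairing_emb: "pairing (emb l) f = jet_pair l f"
  by (simp add: emb_pCons pairing_pCons)

lemma pairing_add_left:
  "h \<in> Halg lam \<Longrightarrow> k \<in> Halg lam \<Longrightarrow> pairing (h + k) f = pairing h f + pairing k f"
proof (induction h arbitrary: k f)
  case (pCons l h)
  obtain l' g where k: "k = pCons l' g" by (cases k)
  then show ?case
    using pCons.prems pCons.IH[of g "dphi f"]
    by (simp add: Halg_pCons pairing_pCons jet_pair_linear[of _ lam] del: plus_fun_apply)
qed simp

lemma pairing_diff_right: "pairing h (f - g) = pairing h f - pairing h g"
  by (induction h arbitrary: f g) (simp_all add: pairing_pCons jet_pair_diff dphi_commute)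

text \<open>Reduces the test on all of H to functions l: each further J on the left replaces f by
  \<open>dphi f\<close>, and T passes through \<open>dphi\<close>. For this T must be one operator
  serving all f.\<close>

lemma is_left_regularI:
  assumes "\<And>l f. l \<in> Lalg lam \<Longrightarrow> pairing (Lact \<omega> lam l k) f = jet_pair l (T f)"
    and "\<And>f. dphi (T f) = T (dphi f)" and k: "k \<in> Halg lam"
  shows "is_left_regular \<omega> lam k f (T f)"
  unfolding is_left_regular_def
proof
  fix h assume "h \<in> Halg lam"
  then show "pairing h (T f) = pairing (Hmult \<omega> lam h k) f"
  proof (induction h arbitrary: f)
    case (pCons l h)
    then have h: "l \<in> Lalg lam" "h \<in> Halg lam" by (simp_all add: Halg_pCons)
    with k have "pairing (Lact \<omega> lam l k + pCons 0 (Hmult \<omega> lam h k)) f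
        = pairing (Lact \<omega> lam l k) f + pairing (pCons 0 (Hmult \<omega> lam h k)) f"
      by (intro pairing_add_left[of _ lam]) (simp_all add: Lact_Halg Halg_pCons Lalg_zero Hmult_Halg)
    with h show ?case
      by (simp add: Hmult_pCons pairing_pCons assms pCons.IH)
  qed simp
qed

text \<open>Functions commute, so right multiplication by l may be transposed as left multiplication
  by l.\<close>

lemma is_left_regular_emb:
  assumes "\<And>l' f. l' \<in> Lalg lam \<Longrightarrow> jet_pair (l * l') f = jet_pair l' (T f)"
    and "\<And>f. dphi (T f) = T (dphi f)" and "l \<in> Lalg lam"
  shows "is_left_regular \<omega> lam (emb l) f (T f)"
  using assms by (intro is_left_regularI) (simp_all add: Lact_emb pairing_emb mult.commute Halg_emb)

text \<open>Associativity of H makes a product act as the composite, with the right factor acting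
  first.\<close>

lemma is_left_regular_Hmult:
  assumes "h \<in> Halg lam" "k \<in> Halg lam"
    "is_left_regular \<omega> lam k f g" "is_left_regular \<omega> lam h g g'"
  shows "is_left_regular \<omega> lam (Hmult \<omega> lam h k) f g'"
  using assms by (simp add: is_left_regular_def Hmult_Halg flip: Hmult_assoc)

lemma Hmult_add_right: "Hmult \<omega> lam h (k + k') = Hmult \<omega> lam h k + Hmult \<omega> lam h k'"
  by (induction h) (simp_all add: Hmult_pCons Lact_add)

lemma is_left_regular_add:
  assumes "h \<in> Halg lam" "k \<in> Halg lam"
    "is_left_regular \<omega> lam h f g" "is_left_regular \<omega> lam k f g'"
  shows "is_left_regular \<omega> lam (h + k) f (g + g')"
proof -
  have "pairing h' (g + g') = pairing h' g + pairing h' g'" for h'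
    using pairing_diff_right[of h' "g + g'" g'] by simp
  then show ?thesis
    using assms by (simp add: is_left_regular_def Hmult_add_right Hmult_Halg pairing_add_left[of _ lam])
qed

section \<open>Nondegeneracy and uniqueness\<close>

lemma jet_pair_one: "jet_pair 1 f = fps_nth (coeff (coeff f 0) 0) 0"
proof (induction f rule: dualF_gen_induct)
  case (abar1 f)
  have "jet_pair 1 (abar1 f) = jet_pair (d1 1) f" by (simp add: jet_pair_d[OF Lalg_one])
  then show ?case using d_basic(1)[of 1] by (simp add: coeff_abar1 one_fun_def)
next
  case (abar2 f)
  have "jet_pair 1 (abar2 f) = jet_pair (d2 1) f" by (simp add: jet_pair_d[OF Lalg_one])
  then show ?case using d_basic(2)[of 1] by (simp add: coeff_abar2 one_fun_def)
qed (simp_all add: jet_pair_monom jet_def jet_pair_add_right)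

text \<open>Multiplying l by \<open>P1\<close> or \<open>P2\<close> shows that the annihilated
  expressions are stable under \<open>da1\<close> and \<open>da2\<close>. These move any
  coefficient, up to a nonzero integer factor, to the constant place, which is read off by l =
  1.\<close>

lemma jet_pair_nondegenerate:
  assumes "\<And>l. l \<in> Lalg lam \<Longrightarrow> jet_pair l f = 0"
  shows "fps_nth (coeff (coeff f s) r) 0 = 0"
  using assms
proof (induction s arbitrary: f)
  case 0
  then show ?case
  proof (induction r arbitrary: f)
    case 0
    from 0[OF Lalg_one] show ?case by (simp only: jet_pair_one)
  next
    case (Suc r)
    have "fps_nth (coeff (coeff (da1 f) 0) r) 0 = 0"
      by (rule Suc.IH) (simp add: Suc.prems Lalg.mult Lalg.P1 del: times_fun_apply flip: jet_pair_P1[of _ lam])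
    then show ?case by (simp add: coeff_da1 fps_mult_nth_0 del: of_nat_Suc)
  qed
next
  case (Suc s)
  have "fps_nth (coeff (coeff (da2 f) s) r) 0 = 0"
    by (rule Suc.IH) (simp add: Suc.prems Lalg.mult Lalg.P2 del: times_fun_apply flip: jet_pair_P2[of _ lam])
  then show ?case by (simp add: coeff_da2 fps_mult_nth_0 del: of_nat_Suc)
qed

text \<open>Testing on J h passes the hypothesis from f to \<open>dphi f\<close>, so the higher
  coefficients in \<phi> reduce to the constant one.\<close>

lemma pairing_nondegenerate:
  assumes "\<And>h. h \<in> Halg lam \<Longrightarrow> pairing h f = 0"
  shows "f = 0"
proof -
  have "fps_nth (coeff (coeff f s) r) m = 0" for s r m
    using assms
  proof (induction m arbitrary: f)
    case 0
    then show ?case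
      by (intro jet_pair_nondegenerate[of lam]) (simp add: Halg_emb flip: pairing_emb)
  next
    case (Suc m)
    have "pairing h (dphi f) = 0" if "h \<in> Halg lam" for h
      using Suc.prems[of "pCons 0 h"] that by (simp add: pairing_pCons Halg_pCons Lalg_zero)
    from Suc.IH[OF this] have "of_nat (Suc m) * fps_nth (coeff (coeff f s) r) (Suc m) = 0"
      by (simp add: coeff_dphi)
    then show ?case by (simp del: of_nat_Suc)
  qed
  then show ?thesis by (intro dualF_eqI fps_ext) simp
qed

lemma is_left_regular_unique:
  assumes "is_left_regular \<omega> lam h f g" "is_left_regular \<omega> lam h f g'"
  shows "g = g'"
proof -
  have "g - g' = 0"
    by (rule pairing_nondegenerate[of lam]) (use assms in \<open>simp add: pairing_diff_right is_left_regular_def\<close>)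
  then show ?thesis by simp
qed

lemma left_regular_eqI: "is_left_regular \<omega> lam h f g \<Longrightarrow> left_regular \<omega> lam h f = g"
  unfolding left_regular_def using is_left_regular_unique by blast

text \<open>The defining identity is tested on J h': left multiplication by J commutes with right
  multiplication by h, and its transpose is \<open>dphi\<close>.\<close>

lemma is_left_regular_dphi:
  assumes "is_left_regular \<omega> lam h f g"
  shows "is_left_regular \<omega> lam h (dphi f) (dphi g)"
  unfolding is_left_regular_def
proof
  fix h' assume "h' \<in> Halg lam"
  then have "pairing (pCons 0 h') g = pairing (Hmult \<omega> lam (pCons 0 h') h) f"
    using assms by (simp add: is_left_regular_def Halg_pCons Lalg_zero)
  then show "pairing h' (dphi g) = pairing (Hmult \<omega> lam h' h) (dphi f)"
    by (simp add: Hmult_pCons pairing_pCons)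
qed

section \<open>Action of the generators\<close>

lemma is_left_regular_P1: "is_left_regular \<omega> lam (emb P1) f (da1 f)"
  by (intro is_left_regular_emb) (simp_all add: jet_pair_P1[of _ lam] dphi_commute Lalg.P1)

lemma is_left_regular_P2: "is_left_regular \<omega> lam (emb P2) f (da2 f)"
  by (intro is_left_regular_emb) (simp_all add: jet_pair_P2[of _ lam] dphi_commute Lalg.P2)

lemma expP2_in_Lalg: "expP2 lam \<in> Lalg lam" "expP2 (- lam) \<in> Lalg lam" "expP2 (- 2 * lam) \<in> Lalg lam"
proof -
  show m: "expP2 (- lam) \<in> Lalg lam"
    using Lalg.exp_neg[of lam] by (simp add: expP2_def)
  show "expP2 lam \<in> Lalg lam"
    using Lalg.exp_pos[of lam] by (simp add: expP2_def)
  have "expP2 (- 2 * lam) = expP2 (- lam) * expP2 (- lam)"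
    by (simp add: expP2_def fun_eq_iff mult.commute mult.left_commute flip: exp_add)
  then show "expP2 (- 2 * lam) \<in> Lalg lam"
    using Lalg.mult[OF m m] by simp
qed

lemma is_left_regular_expP2:
  assumes "expP2 t \<in> Lalg lam"
  shows "is_left_regular \<omega> lam (emb (expP2 t)) f (exp_da2 (of_real t) f)"
  using assms by (intro is_left_regular_emb) (simp_all add: jet_pair_expP2 dphi_exp_da2)

lemma genJ_pCons: "genJ = pCons 0 (emb 1)"
  by (simp add: genJ_def emb_def monom_Suc)

lemma Halg_genJ: "genJ \<in> Halg lam"
  by (simp add: genJ_pCons Halg_pCons Halg_emb Lalg_zero Lalg_one)

text \<open>Splits the coefficients into products of functions whose transposes are known.\<close>

lemma Jhat_eq:
  assumes "lam \<noteq> 0"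
  shows "Jhat \<omega> lam l = (\<lambda>x y. - 1 / (2 * of_real lam)) * d1 l
     + ((\<lambda>x y. 1 / (2 * of_real lam)) * (expP2 (- 2 * lam) * d1 l)
     + ((\<lambda>x y. of_real \<omega>) * (P1 * d2 l)
     + (\<lambda>x y. - (of_real lam / 2 * of_real \<omega>)) * (P1 * (P1 * d1 l))))"
  using assms
  by (simp add: Jhat_def expP2_def P1_def fun_eq_iff field_simps power2_eq_square flip: exp_of_real)

text \<open>The transpose of \<open>Jhat\<close>. Transposition reverses the order, so
  \<open>abar1\<close> and \<open>abar2\<close>, which come from the derivatives, are applied
  last.\<close>

definition J_op :: "real \<Rightarrow> real \<Rightarrow> dualF \<Rightarrow> dualF" where
  "J_op \<omega> lam f =
     - abar1 (cscale (1 / (2 * of_real lam)) (f - exp_da2 (- 2 * of_real lam) f))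
     + cscale (of_real \<omega>) (abar2 (da1 f))
     - cscale (of_real lam / 2 * of_real \<omega>) (abar1 (da1 (da1 f)))"

lemma jet_pair_Jhat:
  assumes "lam \<noteq> 0" "l \<in> Lalg lam"
  shows "jet_pair (Jhat \<omega> lam l) f = jet_pair l (J_op \<omega> lam f)"
proof -
  have E: "jet_pair (expP2 (- 2 * lam) * d1 l) f = jet_pair (d1 l) (exp_da2 (- 2 * of_real lam) f)"
    using jet_pair_expP2[OF expP2_in_Lalg(3) Lalg_d(1)[OF assms(2)], of f] by simp
  show ?thesis
    unfolding Jhat_eq[OF assms(1)] J_op_def
    using assms E
    by (simp add: jet_pair_linear[of _ lam] jet_pair_P1[of _ lam]
        Lalg.mult Lalg.add Lalg.const Lalg.P1 Lalg_d expP2_in_Lalg[simplified]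
        jet_pair_add_right jet_pair_diff jet_pair_minus jet_pair_scale lcoef_commute
        right_diff_distrib del: plus_fun_apply times_fun_apply flip: jet_pair_d[of _ lam])
qed

lemma is_left_regular_genJ:
  assumes "lam \<noteq> 0"
  shows "is_left_regular \<omega> lam genJ f (dphi f + J_op \<omega> lam f)"
proof (rule is_left_regularI[OF _ _ Halg_genJ])
  fix l f assume l: "l \<in> Lalg lam"
  have "Lact \<omega> lam l genJ = pCons 0 (emb l) + emb (Jhat \<omega> lam l)"
    by (simp add: genJ_pCons Lact_pCons Lact_emb)
  then show "pairing (Lact \<omega> lam l genJ) f = jet_pair l (dphi f + J_op \<omega> lam f)"
    using l assms
    by (simp add: pairing_add_left[of _ lam] Halg_pCons Halg_emb Lalg_zero Lalg_Jhat pairing_pCons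
        pairing_emb jet_pair_add_right jet_pair_Jhat del: plus_fun_apply)
next
  fix f
  have "dphi (- g) = - dphi g" for g
    using dphi_commute(6)[of 0 g] by (simp add: ops_zero)
  then show "dphi (dphi f + J_op \<omega> lam f) = dphi (dphi f) + J_op \<omega> lam (dphi f)"
    by (simp add: J_op_def add_ops dphi_commute dphi_exp_da2)
qed

section \<open>Existence of the action for all of H\<close>

lemma is_left_regular_emb_ex: "l \<in> Lalg lam \<Longrightarrow> \<exists>g. is_left_regular \<omega> lam (emb l) f g"
proof (induction arbitrary: f rule: Lalg.induct)
  case (const c)
  have "is_left_regular \<omega> lam (emb (\<lambda>x y. c)) f (cscale c f)"
    by (intro is_left_regular_emb)
       (simp_all add: jet_pair_linear[of _ lam] jet_pair_scale dphi_commute Lalg.const del: times_fun_apply)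
  then show ?case by blast
next
  case (add l l')
  then obtain g g' where "is_left_regular \<omega> lam (emb l) f g" "is_left_regular \<omega> lam (emb l') f g'"
    by blast
  then have "is_left_regular \<omega> lam (emb l + emb l') f (g + g')"
    using add.hyps by (intro is_left_regular_add) (simp_all add: Halg_emb)
  then show ?case by (metis emb_def add_monom)
next
  case (mult l l')
  then obtain g where g: "is_left_regular \<omega> lam (emb l') f g" by blast
  from mult obtain g' where "is_left_regular \<omega> lam (emb l) g g'" by blast
  with g have "is_left_regular \<omega> lam (Hmult \<omega> lam (emb l) (emb l')) f g'"
    using mult.hyps by (intro is_left_regular_Hmult) (simp_all add: Halg_emb)
  moreover have "Hmult \<omega> lam (emb l) (emb l') = emb (l * l')"
    by (simp add: emb_pCons[of l] Hmult_pCons Lact_emb)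
  ultimately show ?case by metis
next
  case exp_pos
  show ?case using is_left_regular_expP2[OF expP2_in_Lalg(1), where \<omega> = \<omega> and f = f] by (auto simp: expP2_def)
next
  case exp_neg
  show ?case using is_left_regular_expP2[OF expP2_in_Lalg(2), where \<omega> = \<omega> and f = f] by (auto simp: expP2_def)
qed (use is_left_regular_P1 is_left_regular_P2 in blast)+

text \<open>H is built from functions by sums and left multiplication by J, and J h acts as h
  followed by J.\<close>

lemma is_left_regular_ex:
  assumes "lam \<noteq> 0" "h \<in> Halg lam"
  shows "\<exists>g. is_left_regular \<omega> lam h f g"
  using assms(2)
proof (induction arbitrary: f rule: Halg_induct)
  case zero
  have "is_left_regular \<omega> lam 0 f 0"
    using pairing_diff_right[of _ f f] Hmult_add_right[of \<omega> lam _ 0 0]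
    by (simp add: is_left_regular_def)
  then show ?case by blast
next
  case (step l h)
  obtain g where g: "is_left_regular \<omega> lam (emb l) f g"
    using is_left_regular_emb_ex step by blast
  obtain g' where g': "is_left_regular \<omega> lam h f g'" using step by blast
  have "is_left_regular \<omega> lam (Hmult \<omega> lam genJ h) f (dphi g' + J_op \<omega> lam g')"
    by (rule is_left_regular_Hmult[OF Halg_genJ step.hyps(2) g' is_left_regular_genJ[OF assms(1)]])
  moreover have "Hmult \<omega> lam genJ h = pCons 0 h"
    by (simp add: genJ_pCons Hmult_pCons Hmult_one)
  ultimately have "is_left_regular \<omega> lam (emb l + pCons 0 h) f (g + (dphi g' + J_op \<omega> lam g'))"
    using g step by (intro is_left_regular_add) (simp_all add: Halg_emb Halg_pCons Lalg_zero)
  then show ?case by blast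
qed

section \<open>Stability of the subalgebra and the final formulas\<close>

text \<open>In characteristic zero a power series with zero derivative is constant.\<close>

lemma Aalg_iff_dphi: "f \<in> Aalg \<omega> lam \<longleftrightarrow> dphi f = 0"
proof
  assume "dphi f = 0"
  then have "fps_deriv (coeff (coeff f s) r) = 0" for s r
    by (metis coeff_dphi coeff_0)
  then show "f \<in> Aalg \<omega> lam"
    unfolding Aalg_eq by (auto simp: fps_deriv_eq_0_iff)
qed (auto simp: Aalg_eq intro: dphi_const)

text \<open>If \<open>dphi f\<close> is zero, then \<open>dphi g\<close> is a result of acting on 0,
  hence zero by uniqueness.\<close>

lemma left_regular_Aalg:
  assumes "lam \<noteq> 0" "h \<in> Halg lam" "f \<in> Aalg \<omega> lam"
  shows "left_regular \<omega> lam h f \<in> Aalg \<omega> lam"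
proof -
  obtain g where g: "is_left_regular \<omega> lam h f g"
    using is_left_regular_ex assms by blast
  have "is_left_regular \<omega> lam h 0 (dphi g)"
    using is_left_regular_dphi[OF g] assms(3) by (simp add: Aalg_iff_dphi)
  moreover have "pairing h' 0 = 0" for h'
    using pairing_diff_right[of h' 0 0] by simp
  then have "is_left_regular \<omega> lam h 0 0"
    by (simp add: is_left_regular_def)
  ultimately have "dphi g = 0" by (rule is_left_regular_unique)
  then show ?thesis
    using left_regular_eqI[OF g] by (simp add: Aalg_iff_dphi)
qed

theorem mainTheorem3:
  fixes \<omega> lam :: real
  assumes "lam \<noteq> 0"
  shows
    "(\<forall>h\<in>Halg lam. \<forall>f. \<exists>!g. is_left_regular \<omega> lam h f g) \<and>
     (\<forall>f. left_regular \<omega> lam genJ f =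
        dphi f
        - abar1 (cscale (1 / (2 * of_real lam)) (f - exp_da2 (- 2 * of_real lam) f))
        + cscale (of_real \<omega>) (abar2 (da1 f))
        - cscale (of_real lam / 2 * of_real \<omega>) (abar1 (da1 (da1 f)))) \<and>
     (\<forall>f. left_regular \<omega> lam (emb P1) f = da1 f) \<and>
     (\<forall>f. left_regular \<omega> lam (emb P2) f = da2 f) \<and>
     (\<forall>h\<in>Halg lam. \<forall>\<psi>\<in>Aalg \<omega> lam. left_regular \<omega> lam h \<psi> \<in> Aalg \<omega> lam) \<and>
     (\<forall>\<psi>\<in>Aalg \<omega> lam. restr_regular \<omega> lam genJ \<psi> =
        - abar1 (cscale (1 / (2 * of_real lam)) (\<psi> - exp_da2 (- 2 * of_real lam) \<psi>))
        + cscale (of_real \<omega>) (abar2 (da1 \<psi>))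
        - cscale (of_real lam / 2 * of_real \<omega>) (abar1 (da1 (da1 \<psi>)))) \<and>
     (\<forall>\<psi>\<in>Aalg \<omega> lam. restr_regular \<omega> lam (emb P1) \<psi> = da1 \<psi>) \<and>
     (\<forall>\<psi>\<in>Aalg \<omega> lam. restr_regular \<omega> lam (emb P2) \<psi> = da2 \<psi>)"
proof -
  have J: "left_regular \<omega> lam genJ f = dphi f + J_op \<omega> lam f" for f
    using is_left_regular_genJ[OF assms] by (rule left_regular_eqI)
  have P: "left_regular \<omega> lam (emb P1) f = da1 f" "left_regular \<omega> lam (emb P2) f = da2 f" for f
    by (intro left_regular_eqI is_left_regular_P1 is_left_regular_P2)+
  \<comment> \<open>On the subalgebra the summand \<open>dphi\<close> vanishes, which turns the
    general formula for J into the restricted one.\<close>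
  show ?thesis
    using is_left_regular_ex[OF assms] is_left_regular_unique left_regular_Aalg[OF assms]
    by (auto simp: J P J_op_def restr_regular_def Aalg_iff_dphi)
qed

end
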